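(* Let $G$ be a Hausdorff, locally quasiconvex, abelian topological group which is a $k_\omega$ space and is not locally compact. Let $\kappa$ be the compact weight of $G$, and let $\lambda$ be the minimum of the compact weights of the quotient groups $G/H$, where $H$ ranges over all compact subgroups of $G$. Then the character of $G$ is $$\chi(G)=\max\bigl(\mathfrak d,\ \kappa,\ \mathrm{cof}([\lambda]^{\aleph_0})\bigr).$$
   Context: The character $\chi(G)$ of a topological group is the minimal cardinality of a local base at the identity. The weight of a space is the minimal cardinality of a base of its topology; the compact weight of a space $X$ is the supremum of the weights of the compact subsets of $X$. A topological space $X$ is $k_\omega$ if there are compact sets $K_1,K_2,\dots\subseteq X$ such that each compact $K\subseteq X$ is contained in some $K_n$, and each $U\subseteq X$ such that $U\cap K_n$ is open in $K_n$ for all $n$ is open in $X$. For a partially ordered set $P$, a subset $C$ is cofinal if each $p\in P$ satisfies $p\le c$ for some $c\in C$; $\mathrm{cof}(P)$ is the minimal cardinality of a cofinal subset. $\mathfrak d$ is the cofinality of $\mathbb N^{\mathbb N}$ ordered by $f\le g$ iff $f(n)\le g(n)$ for all $n$. $[\lambda]^{\aleph_0}$ is the family of all countably infinite subsets of $\lambda$, ordered by inclusion. Local quasiconvexity: let $\mathbb T=\mathbb R/\mathbb Z$, identified with $[-1/2,1/2)$, and let $\widehat G$ be the group of continuous homomorphisms $G\to\mathbb T$. A set $A\subseteq G$ is quasiconvex if for each $g\in G\setminus A$ there is $\chi\in\widehat G$ with $|\chi(a)|\le 1/4$ for all $a\in A$ and $|\chi(g)|>1/4$. $G$ is locally quasiconvex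 if it has a neighborhood base at $0$ consisting of quasiconvex sets. *)

theory Defs
  imports "HOL-Analysis.Analysis"
begin

unbundle cardinal_syntax

section \<open>Cardinals\<close>

text \<open>A cardinal number is represented, as in the library, by a cardinal well-order up to
  \<open>=o\<close>.\<close>

definition min_Card :: "'a rel set \<Rightarrow> 'a rel" where
  "min_Card R = (SOME r. r \<in> R \<and> (\<forall>s\<in>R. r \<le>o s))"

lemma min_Card:
  assumes "R \<noteq> {}" "\<forall>r\<in>R. Card_order r"
  shows "min_Card R \<in> R" "\<forall>s\<in>R. min_Card R \<le>o s"
proof -
  have "\<exists>r. r \<in> R \<and> (\<forall>s\<in>R. r \<le>o s)"
    using exists_minim_Card_order[OF assms] by blast
  from someI_ex[OF this]
  show "min_Card R \<in> R" "\<forall>s\<in>R. min_Card R \<le>o s"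
    unfolding min_Card_def by auto
qed

text \<open>The supremum of a set of cardinals on \<^typ>\<open>'a\<close> exists on \<^typ>\<open>'a\<close>
  itself, since the cardinal of the whole type is an upper bound.\<close>

definition sup_Card :: "'a rel set \<Rightarrow> 'a rel" where
  "sup_Card R = min_Card {r. Card_order r \<and> (\<forall>s\<in>R. s \<le>o r)}"

lemma sup_Card:
  fixes R :: "'a rel set"
  assumes "\<forall>r\<in>R. Card_order r"
  shows "Card_order (sup_Card R)" "\<forall>s\<in>R. s \<le>o sup_Card R"
    "\<forall>r :: 'a rel. Card_order r \<and> (\<forall>s\<in>R. s \<le>o r) \<longrightarrow> sup_Card R \<le>o r"
proof -
  let ?U = "{r :: 'a rel. Card_order r \<and> (\<forall>s\<in>R. s \<le>o r)}"
  have "s \<le>o |UNIV :: 'a set|" if "s \<in> R" for s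
    using that assms card_of_Field_ordIso card_of_mono1[OF subset_UNIV]
      ordIso_ordLeq_trans ordIso_symmetric by metis
  hence ne: "?U \<noteq> {}" using card_of_Card_order[of "UNIV :: 'a set"] by blast
  have "\<forall>r\<in>?U. Card_order r" by blast
  from min_Card[OF ne this] show "Card_order (sup_Card R)" "\<forall>s\<in>R. s \<le>o sup_Card R"
    "\<forall>r :: 'a rel. Card_order r \<and> (\<forall>s\<in>R. s \<le>o r) \<longrightarrow> sup_Card R \<le>o r"
    unfolding sup_Card_def by auto
qed

text \<open>The two arguments may live on different types, so the larger of them is moved
  to the sum type.\<close>

definition max_Card :: "'a rel \<Rightarrow> 'b rel \<Rightarrow> ('a + 'b) rel" where
  "max_Card r s = (if r \<le>o s then |Inr ` Field s| else |Inl ` Field r| )"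

lemma max_Card:
  assumes "Card_order r" "Card_order s"
  shows "r \<le>o s \<Longrightarrow> max_Card r s =o s" "s \<le>o r \<Longrightarrow> max_Card r s =o r"
proof -
  have l: "|(Inl :: 'a \<Rightarrow> 'a + 'b) ` Field r| =o r"
  proof -
    have "bij_betw (Inl :: 'a \<Rightarrow> 'a + 'b) (Field r) (Inl ` Field r)"
      by (simp add: bij_betw_def inj_on_def)
    hence "|Field r| =o |(Inl :: 'a \<Rightarrow> 'a + 'b) ` Field r|"
      using card_of_ordIso by blast
    thus ?thesis
      using card_of_Field_ordIso[OF assms(1)] ordIso_symmetric ordIso_transitive by blast
  qed
  have rr: "|(Inr :: 'b \<Rightarrow> 'a + 'b) ` Field s| =o s"
  proof -
    have "bij_betw (Inr :: 'b \<Rightarrow> 'a + 'b) (Field s) (Inr ` Field s)"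
      by (simp add: bij_betw_def inj_on_def)
    hence "|Field s| =o |(Inr :: 'b \<Rightarrow> 'a + 'b) ` Field s|"
      using card_of_ordIso by blast
    thus ?thesis
      using card_of_Field_ordIso[OF assms(2)] ordIso_symmetric ordIso_transitive by blast
  qed
  show "r \<le>o s \<Longrightarrow> max_Card r s =o s"
    using rr by (simp add: max_Card_def)
  show "max_Card r s =o r" if "s \<le>o r"
  proof (cases "r \<le>o s")
    case True
    hence "s =o r" using that by (simp add: ordIso_iff_ordLeq)
    thus ?thesis using True rr ordIso_transitive by (auto simp: max_Card_def)
  next
    case False
    thus ?thesis using l by (simp add: max_Card_def)
  qed
qed

definition cofinal_in :: "'a set \<Rightarrow> ('a \<Rightarrow> 'a \<Rightarrow> bool) \<Rightarrow> 'a set \<Rightarrow> bool" where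
  "cofinal_in P le C \<longleftrightarrow> C \<subseteq> P \<and> (\<forall>p\<in>P. \<exists>c\<in>C. le p c)"

definition cof :: "'a set \<Rightarrow> ('a \<Rightarrow> 'a \<Rightarrow> bool) \<Rightarrow> 'a rel" where
  "cof P le = min_Card { |C| |C. cofinal_in P le C}"

text \<open>The order on \<^typ>\<open>nat \<Rightarrow> nat\<close> is the pointwise one.\<close>

definition dominating_number :: "(nat \<Rightarrow> nat) rel" where
  "dominating_number = cof UNIV (\<le>)"

definition countably_infinite_subsets :: "'a rel \<Rightarrow> 'a set set" where
  "countably_infinite_subsets r = {A. A \<subseteq> Field r \<and> countable A \<and> infinite A}"


section \<open>Topological spaces\<close>

definition base_of :: "'a topology \<Rightarrow> 'a set set \<Rightarrow> bool" where
  "base_of X B \<longleftrightarrow> (\<forall>V\<in>B. openin X V) \<and>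
     (\<forall>U x. openin X U \<and> x \<in> U \<longrightarrow> (\<exists>V\<in>B. x \<in> V \<and> V \<subseteq> U))"

definition weight :: "'a topology \<Rightarrow> 'a set rel" where
  "weight X = min_Card { |B| |B. base_of X B}"

definition compact_weight :: "'a topology \<Rightarrow> 'a set rel" where
  "compact_weight X = sup_Card {weight (subtopology X K) |K. compactin X K}"

definition k_omega_space :: "'a topology \<Rightarrow> bool" where
  "k_omega_space X \<longleftrightarrow> (\<exists>K :: nat \<Rightarrow> 'a set.
     (\<forall>n. compactin X (K n)) \<and>
     (\<forall>L. compactin X L \<longrightarrow> (\<exists>n. L \<subseteq> K n)) \<and>
     (\<forall>U. U \<subseteq> topspace X \<and> (\<forall>n. openin (subtopology X (K n)) (U \<inter> K n)) \<longrightarrow> openin X U))"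

definition local_base_at :: "'a \<Rightarrow> 'a topology \<Rightarrow> 'a set set \<Rightarrow> bool" where
  "local_base_at x X B \<longleftrightarrow> (\<forall>V\<in>B. openin X V \<and> x \<in> V) \<and>
     (\<forall>U. openin X U \<and> x \<in> U \<longrightarrow> (\<exists>V\<in>B. V \<subseteq> U))"


section \<open>Abelian topological groups\<close>

text \<open>The cardinal invariant, not a homomorphism into the circle.\<close>

definition topological_character :: "'a :: topological_ab_group_add itself \<Rightarrow> 'a set rel" where
  "topological_character _ = min_Card { |B| |B. local_base_at (0::'a) euclidean B}"

definition add_subgroup :: "'a :: ab_group_add set \<Rightarrow> bool" where
  "add_subgroup H \<longleftrightarrow> 0 \<in> H \<and> (\<forall>x\<in>H. \<forall>y\<in>H. x + y \<in> H) \<and> (\<forall>x\<in>H. - x \<in> H)"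

text \<open>The space of the quotient group by \<open>H\<close>: its points are the cosets
  \<open>x +o H\<close>, with the quotient topology of the projection.\<close>

definition quotient_space :: "'a :: topological_ab_group_add set \<Rightarrow> 'a set topology" where
  "quotient_space H =
     topology (\<lambda>U. U \<subseteq> range (\<lambda>x. x +o H) \<and> open {x. x +o H \<in> U})"

lemma openin_quotient_space:
  "openin (quotient_space H) U \<longleftrightarrow> U \<subseteq> range (\<lambda>x. x +o H) \<and> open {x. x +o H \<in> U}"
proof -
  let ?P = "\<lambda>U. U \<subseteq> range (\<lambda>x. x +o H) \<and> open {x. x +o H \<in> U}"
  have "istopology ?P"
    unfolding istopology_def
  proof (intro conjI allI impI)
    fix S T assume "?P S" "?P T"
    moreover have "{x. x +o H \<in> S \<inter> T} = {x. x +o H \<in> S} \<inter> {x. x +o H \<in> T}" by auto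
    ultimately show "S \<inter> T \<subseteq> range (\<lambda>x. x +o H)" "open {x. x +o H \<in> S \<inter> T}"
      by (auto intro: open_Int)
  next
    fix \<K> assume *: "\<forall>K\<in>\<K>. ?P K"
    then show "\<Union>\<K> \<subseteq> range (\<lambda>x. x +o H)" by blast
    have "{x. x +o H \<in> \<Union>\<K>} = (\<Union>K\<in>\<K>. {x. x +o H \<in> K})" by auto
    then show "open {x. x +o H \<in> \<Union>\<K>}" using * by auto
  qed
  then show ?thesis by (simp add: quotient_space_def topology_inverse')
qed

lemma topspace_quotient_space: "topspace (quotient_space H) = range (\<lambda>x. x +o H)"
proof (rule antisym)
  have "{x. x +o H \<in> range (\<lambda>x. x +o H)} = UNIV" by auto
  then have "openin (quotient_space H) (range (\<lambda>x. x +o H))"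
    by (simp add: openin_quotient_space)
  then show "range (\<lambda>x. x +o H) \<subseteq> topspace (quotient_space H)"
    by (rule openin_subset)
qed (auto simp: topspace_def openin_quotient_space)

lemma quotient_map_quotient_space:
  "quotient_map euclidean (quotient_space H) (\<lambda>x. x +o H)"
  by (auto simp: quotient_map_def topspace_quotient_space openin_quotient_space)

text \<open>The circle group is \<open>\<real>/\<int>\<close> as a special case: its points are the cosets of
  \<^term>\<open>\<int> :: real set\<close>, added as sets, and the absolute value of a coset is that of its
  representative in \<open>[-1/2, 1/2)\<close>.\<close>

definition circle_abs :: "real set \<Rightarrow> real" where
  "circle_abs c = \<bar>THE x. x \<in> c \<and> -1/2 \<le> x \<and> x < 1/2\<bar>"

lemma circle_abs:
  assumes "-1/2 \<le> x" "x < 1/2"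
  shows "circle_abs (x +o \<int>) = \<bar>x\<bar>"
proof -
  have "(THE y. y \<in> x +o \<int> \<and> -1/2 \<le> y \<and> y < 1/2) = x"
  proof (rule the_equality)
    show "x \<in> x +o \<int> \<and> -1/2 \<le> x \<and> x < 1/2"
      using assms Ints_0 by (force simp: elt_set_plus_def)
  next
    fix y assume y: "y \<in> x +o \<int> \<and> -1/2 \<le> y \<and> y < 1/2"
    then obtain n where n: "y = x + of_int n"
      by (auto simp: elt_set_plus_def elim!: Ints_cases)
    with y assms have "real_of_int n < 1" "real_of_int n > -1" by linarith+
    then have "n = 0" by linarith
    with n show "y = x" by simp
  qed
  then show ?thesis by (simp add: circle_abs_def)
qed

lemma circle_add: "(x +o \<int>) + (y +o \<int>) = (x + y) +o (\<int> :: real set)"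
proof -
  have "\<int> + \<int> = (\<int> :: real set)"
    by (auto simp: set_plus_def intro: Ints_add) (metis Ints_0 add_0)
  then show ?thesis by (simp add: set_plus_rearrange)
qed

definition dual_group :: "('a :: topological_ab_group_add \<Rightarrow> real set) set" where
  "dual_group = {\<psi>. continuous_map euclidean (quotient_space \<int>) \<psi> \<and>
                     (\<forall>x y. \<psi> (x + y) = \<psi> x + \<psi> y)}"

definition quasiconvex :: "'a :: topological_ab_group_add set \<Rightarrow> bool" where
  "quasiconvex A \<longleftrightarrow> (\<forall>g. g \<notin> A \<longrightarrow>
     (\<exists>\<psi>\<in>dual_group. (\<forall>a\<in>A. circle_abs (\<psi> a) \<le> 1/4) \<and> circle_abs (\<psi> g) > 1/4))"

definition locally_quasiconvex :: "'a :: topological_ab_group_add itself \<Rightarrow> bool" where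
  "locally_quasiconvex _ \<longleftrightarrow> neighbourhood_base_at (0::'a) quasiconvex euclidean"

end

theory Submission
  imports Defs
begin

text \<open>Realise the dual of \<open>G\<close> as the group of continuous characters into the unit circle of the
  complex plane, with the uniform distances on the compact sets \<open>K n\<close> of a \<open>k\<^sub>\<omega>\<close> decomposition. By
  local quasiconvexity, taking polars is a Tukey equivalence between the neighbourhoods of \<open>0\<close> in
  \<open>G\<close> and the sets of characters that are totally bounded for all these distances, so the character
  of \<open>G\<close> is the cofinality of the family of these sets. Compact subgroups \<open>H\<close> of \<open>G\<close> correspond to
  open groups of characters, and weights of compact sets to densities.

  A totally bounded set lies in finitely many cosets of the open subgroup belonging to \<open>H\<close>; inside
  it, a countable subset of a dense set together with a function from \<open>\<nat>\<close> to \<open>\<nat>\<close> describes finite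
  nets at all scales. This gives the upper bound. Conversely, every ball \<open>U n\<close> of characters fails
  to be totally bounded, as \<open>G\<close> is not locally compact. A choice of finitely many points in each
  \<open>U n\<close> is totally bounded, while a totally bounded set contains only finitely many points of a
  uniformly separated one. Hence infinite separated sequences in the balls give \<open>\<dd>\<close>, and injections
  of \<open>\<lambda>\<close> into countable unions of separated sets in the balls give the cofinality of
  \<open>[\<lambda>]\<^sup>\<aleph>\<^sup>0\<close>.\<close>

section \<open>Cardinals\<close>

lemma min_Card_attained:
  assumes "Q B"
  obtains C where "Q C" "min_Card { |B| |B. Q B} = |C|"
proof -
  have "min_Card { |B| |B. Q B} \<in> { |B| |B. Q B}"
    using assms by (intro min_Card(1)) (auto simp: card_of_Card_order)
  then show thesis using that by auto
qed

lemma min_Card_le: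
  assumes "Q B"
  shows "min_Card { |B| |B. Q B} \<le>o |B|"
proof -
  have "\<forall>s\<in>{ |B| |B. Q B}. min_Card { |B| |B. Q B} \<le>o s"
    using assms by (intro min_Card(2)) (auto simp: card_of_Card_order)
  then show ?thesis using assms by auto
qed

text \<open>\<open>sup_Card(3)\<close> compares only with cardinals on the same type. If all of
  \<open>'a\<close> embeds into \<open>Field r\<close>, the supremum is small anyway; otherwise
  \<open>r\<close> has a copy on \<open>'a\<close>, and that copy is an upper bound there.\<close>

lemma sup_Card_least:
  fixes R :: "'a rel set" and r :: "'b rel"
  assumes R: "\<forall>s\<in>R. Card_order s" and r: "Card_order r" and le: "\<And>s. s \<in> R \<Longrightarrow> s \<le>o r"
  shows "sup_Card R \<le>o r"
proof -
  have fr: "|Field r| =o r" using card_of_Field_ordIso[OF r] .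
  consider "|UNIV :: 'a set| \<le>o |Field r|" | "|Field r| \<le>o |UNIV :: 'a set|"
    using ordLeq_total[OF card_of_Well_order card_of_Well_order] by blast
  then show ?thesis
  proof cases
    case 1
    have "sup_Card R =o |Field (sup_Card R)|"
      using card_of_Field_ordIso[OF sup_Card(1)[OF R]] ordIso_symmetric by blast
    also have "|Field (sup_Card R)| \<le>o |UNIV :: 'a set|" by (rule card_of_mono1) simp
    also note 1
    also note fr
    finally show ?thesis .
  next
    case 2
    then obtain f :: "'b \<Rightarrow> 'a" where "inj_on f (Field r)"
      by (meson card_of_ordLeq)
    then have "|Field r| =o |f ` Field r|"
      using card_of_ordIso bij_betw_imageI by blast
    then have e: "r =o |f ` Field r|"
      using fr ordIso_symmetric ordIso_transitive by blast
    have "sup_Card R \<le>o |f ` Field r|"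
      using sup_Card(3)[OF R] le e card_of_Card_order ordLeq_ordIso_trans by blast
    then show ?thesis using e ordIso_symmetric ordLeq_ordIso_trans by blast
  qed
qed

lemma Card_order_max_Card: "Card_order (max_Card r s)"
  by (simp add: max_Card_def card_of_Card_order)

lemma max_Card_upper:
  assumes "Card_order r" "Card_order s"
  shows "r \<le>o max_Card r s" "s \<le>o max_Card r s"
proof -
  have "r \<le>o s \<or> s \<le>o r"
    by (rule ordLeq_total) (use assms card_order_on_well_order_on in auto)
  then have "r \<le>o max_Card r s \<and> s \<le>o max_Card r s"
  proof
    assume "r \<le>o s"
    moreover from max_Card(1)[OF assms this] have "s \<le>o max_Card r s"
      by (simp add: ordIso_iff_ordLeq)
    ultimately show ?thesis using ordLeq_transitive[of r s "max_Card r s"] by simp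
  next
    assume "s \<le>o r"
    moreover from max_Card(2)[OF assms this] have "r \<le>o max_Card r s"
      by (simp add: ordIso_iff_ordLeq)
    ultimately show ?thesis using ordLeq_transitive[of s r "max_Card r s"] by simp
  qed
  then show "r \<le>o max_Card r s" "s \<le>o max_Card r s" by auto
qed

lemma max_Card_least:
  assumes "Card_order r" "Card_order s" "r \<le>o t" "s \<le>o t"
  shows "max_Card r s \<le>o t"
proof -
  have "r \<le>o s \<or> s \<le>o r"
    by (rule ordLeq_total) (use assms card_order_on_well_order_on in auto)
  then show ?thesis
  proof
    assume "r \<le>o s"
    from ordIso_ordLeq_trans[OF max_Card(1)[OF assms(1,2) this] assms(4)] show ?thesis .
  next
    assume "s \<le>o r"
    from ordIso_ordLeq_trans[OF max_Card(2)[OF assms(1,2) this] assms(3)] show ?thesis .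
  qed
qed

section \<open>Cardinal arithmetic below an infinite cardinal\<close>

lemma card_of_image_ordLeq: "|A| \<le>o r \<Longrightarrow> |f ` A| \<le>o r"
  using card_of_image ordLeq_transitive by blast

lemma card_of_subset_ordLeq: "A \<subseteq> B \<Longrightarrow> |B| \<le>o r \<Longrightarrow> |A| \<le>o r"
  using card_of_mono1 ordLeq_transitive by blast

lemma countable_ordLeq_Cinfinite:
  assumes "countable A" "Cinfinite r"
  shows "|A| \<le>o r"
proof -
  have "|A| \<le>o |UNIV :: nat set|"
    using countableE[OF assms(1)] card_of_ordLeq[of A "UNIV :: nat set"] by auto
  also have "|UNIV :: nat set| \<le>o r"
    by (rule ordIso_ordLeq_trans[OF card_of_nat natLeq_ordLeq_cinfinite[OF assms(2)]])
  finally show ?thesis .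
qed

lemma Cinfinite_card_of: "infinite A \<Longrightarrow> Cinfinite |A|"
  by (simp add: cinfinite_def Field_card_of card_of_card_order_on)

lemma card_of_Times_ordLeq_Cinfinite:
  "|A| \<le>o r \<Longrightarrow> |B| \<le>o r \<Longrightarrow> Cinfinite r \<Longrightarrow> |A \<times> B| \<le>o r"
  by (simp add: card_of_Times_ordLeq_infinite_Field cinfinite_def)

text \<open>Finite subsets are the ranges of finite lists; lists of a fixed length are bounded by
  induction through products, and there are countably many lengths.\<close>

lemma card_of_finite_subsets_ordLeq:
  assumes A: "|A| \<le>o r" and r: "Cinfinite r"
  shows "|{F. F \<subseteq> A \<and> finite F}| \<le>o r"
proof -
  let ?L = "\<lambda>n. {xs. set xs \<subseteq> A \<and> length xs = n}"
  have L: "|?L n| \<le>o r" for n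
  proof (induction n)
    case 0
    have "?L 0 \<subseteq> {[]}" by auto
    then have "countable (?L 0)" by (rule countable_subset) simp
    then show ?case using r by (rule countable_ordLeq_Cinfinite)
  next
    case (Suc n)
    have "?L (Suc n) = (\<lambda>(x, xs). x # xs) ` (A \<times> ?L n)"
      by (auto simp: length_Suc_conv image_iff)
    then show ?case
      using card_of_image_ordLeq[OF card_of_Times_ordLeq_Cinfinite[OF A Suc r]] by simp
  qed
  have "|\<Union>n\<in>(UNIV :: nat set). ?L n| \<le>o r"
    using L r countable_ordLeq_Cinfinite[of "UNIV :: nat set" r]
    by (intro UNION_Cinfinite_bound) auto
  then have "|set ` (\<Union>n. ?L n)| \<le>o r" by (rule card_of_image_ordLeq)
  moreover have "{F. F \<subseteq> A \<and> finite F} \<subseteq> set ` (\<Union>n. ?L n)"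
    using finite_list by fastforce
  ultimately show ?thesis by (rule card_of_subset_ordLeq[rotated])
qed

text \<open>Choosing one point for each realised code gives a net that is no larger than the set of
  codes.\<close>

lemma net_from_codes:
  assumes "\<And>f. f \<in> \<Phi> \<Longrightarrow> \<exists>t\<in>T. R f t"
  obtains \<Psi> h where "\<Psi> \<subseteq> \<Phi>" "\<Psi> \<subseteq> h ` T" "\<forall>f\<in>\<Phi>. \<exists>g\<in>\<Psi>. \<exists>t\<in>T. R f t \<and> R g t"
proof -
  define h where "h t = (SOME f. f \<in> \<Phi> \<and> R f t)" for t
  have h: "h t \<in> \<Phi> \<and> R (h t) t" if "f \<in> \<Phi>" "R f t" for f t
    unfolding h_def by (rule someI[of _ f]) (use that in auto)
  show thesis
  proof (rule that[of "h ` {t\<in>T. \<exists>f\<in>\<Phi>. R f t}" h])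
    show "\<forall>f\<in>\<Phi>. \<exists>g\<in>h ` {t\<in>T. \<exists>f\<in>\<Phi>. R f t}. \<exists>t\<in>T. R f t \<and> R g t"
    proof
      fix f assume f: "f \<in> \<Phi>"
      then obtain t where "t \<in> T" "R f t" using assms by blast
      then show "\<exists>g\<in>h ` {t\<in>T. \<exists>f\<in>\<Phi>. R f t}. \<exists>t\<in>T. R f t \<and> R g t"
        using h f by blast
    qed
  qed (use h in auto)
qed

section \<open>Weight\<close>

lemma compactin_subcover:
  assumes "compactin X S" "\<And>U. U \<in> \<U> \<Longrightarrow> openin X U" "S \<subseteq> \<Union>\<U>"
  obtains \<F> where "finite \<F>" "\<F> \<subseteq> \<U>" "S \<subseteq> \<Union>\<F>"
  using assms unfolding compactin_def by meson

lemma openin_base_of: "base_of X {U. openin X U}"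
  by (auto simp: base_of_def)

lemma weight_attained:
  obtains B where "base_of X B" "weight X = |B|"
proof (rule min_Card_attained[where Q="base_of X", OF openin_base_of])
  fix C assume "base_of X C" "min_Card { |B| |B. base_of X B} = |C|"
  then show thesis using that unfolding weight_def by simp
qed

lemma Card_order_weight: "Card_order (weight X)"
  by (rule weight_attained[of X]) (simp add: card_of_Card_order)

lemma weight_le: "base_of X B \<Longrightarrow> weight X \<le>o |B|"
  unfolding weight_def by (rule min_Card_le)

lemma Card_order_compact_weight: "Card_order (compact_weight X)"
  unfolding compact_weight_def by (rule sup_Card) (auto simp: Card_order_weight)

lemma weight_le_compact_weight:
  "compactin X L \<Longrightarrow> weight (subtopology X L) \<le>o compact_weight X"
  unfolding compact_weight_def
  by (rule sup_Card(2)[rule_format]) (auto simp: Card_order_weight)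

lemma compact_weight_least:
  assumes "Card_order r" "\<And>L. compactin X L \<Longrightarrow> weight (subtopology X L) \<le>o r"
  shows "compact_weight X \<le>o r"
  unfolding compact_weight_def by (rule sup_Card_least) (use assms in \<open>auto simp: Card_order_weight\<close>)

text \<open>Finite intersections of preimages, under members of \<open>F\<close>, of sets in a
  countable basis of the plane form a base. Given \<open>x\<close> in an open \<open>U\<close>, each
  point of the compact complement is separated from \<open>x\<close> by one function, and finitely
  many of these separations cover the complement.\<close>

lemma weight_le_separating:
  fixes F :: "('a \<Rightarrow> complex) set"
  assumes Y: "compact_space Y" and F: "|F| \<le>o r" and r: "Cinfinite r"
    and cont: "\<And>f. f \<in> F \<Longrightarrow> continuous_map Y euclidean f"
    and sep: "\<And>x y. x \<in> topspace Y \<Longrightarrow> y \<in> topspace Y \<Longrightarrow> x \<noteq> y \<Longrightarrow> \<exists>f\<in>F. f x \<noteq> f y"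
  shows "weight Y \<le>o r"
proof -
  obtain \<B> :: "complex set set" where \<B>: "countable \<B>" "topological_basis \<B>"
    using ex_countable_basis by blast
  \<comment> \<open>A finite set \<open>T\<close> of pairs lists constraints on a point; the empty
    list yields the whole space.\<close>
  define G where "G T = {y\<in>topspace Y. \<forall>(f, b)\<in>T. f y \<in> b}" for T :: "(('a \<Rightarrow> complex) \<times> complex set) set"
  define \<T> where "\<T> = {T. T \<subseteq> F \<times> \<B> \<and> finite T}"
  have pre: "openin Y {y\<in>topspace Y. f y \<in> b}" if "f \<in> F" "b \<in> \<B>" for f b
    by (rule openin_continuous_map_preimage[OF cont[OF that(1)]])
      (simp add: topological_basis_open[OF \<B>(2) that(2)])
  have Gopen: "openin Y (G T)" if "T \<in> \<T>" for T
  proof (cases "T = {}")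
    case False
    then have "G T = (\<Inter>p\<in>T. {y\<in>topspace Y. fst p y \<in> snd p})"
      by (auto simp: G_def case_prod_unfold)
    then show ?thesis using that False pre
      by (auto simp: \<T>_def intro!: openin_Inter)
  qed (simp add: G_def)
  have "base_of Y (G ` \<T>)"
    unfolding base_of_def
  proof (intro conjI allI impI ballI)
    fix U x assume "openin Y U \<and> x \<in> U"
    then have U: "openin Y U" and x: "x \<in> U" and xY: "x \<in> topspace Y"
      using openin_subset by auto
    have "\<exists>f\<in>F. \<exists>b\<in>\<B>. \<exists>c\<in>\<B>. f x \<in> b \<and> f z \<in> c \<and> b \<inter> c = {}" if z: "z \<in> topspace Y - U" for z
    proof -
      obtain f where f: "f \<in> F" "f x \<noteq> f z" using sep[OF xY, of z] z x by blast
      then obtain M N where "open M" "open N" "f x \<in> M" "f z \<in> N" "M \<inter> N = {}"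
        using hausdorff[OF f(2)] by blast
      then obtain b c where "b \<in> \<B>" "f x \<in> b" "b \<subseteq> M" "c \<in> \<B>" "f z \<in> c" "c \<subseteq> N"
        using topological_basisE[OF \<B>(2)] by metis
      then show ?thesis using f(1) \<open>M \<inter> N = {}\<close> by blast
    qed
    then obtain f b c where fbc: "\<And>z. z \<in> topspace Y - U \<Longrightarrow>
        f z \<in> F \<and> b z \<in> \<B> \<and> c z \<in> \<B> \<and> f z x \<in> b z \<and> f z z \<in> c z \<and> b z \<inter> c z = {}"
      by metis
    have "compactin Y (topspace Y - U)"
      using Y U by (intro closedin_compact_space) (auto simp: closedin_def)
    then obtain D where D: "finite D" "D \<subseteq> (\<lambda>z. {y\<in>topspace Y. f z y \<in> c z}) ` (topspace Y - U)"
        "topspace Y - U \<subseteq> \<Union>D"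
      by (rule compactin_subcover[where \<U>="(\<lambda>z. {y\<in>topspace Y. f z y \<in> c z}) ` (topspace Y - U)"])
        (use fbc pre in auto)
    then obtain Z where Z: "finite Z" "Z \<subseteq> topspace Y - U" "D = (\<lambda>z. {y\<in>topspace Y. f z y \<in> c z}) ` Z"
      by (meson finite_subset_image)
    define T where "T = (\<lambda>z. (f z, b z)) ` Z"
    have "T \<in> \<T>" using Z fbc by (auto simp: T_def \<T>_def)
    moreover have "x \<in> G T" using Z fbc xY by (auto simp: G_def T_def)
    moreover have "G T \<subseteq> U"
    proof
      fix y assume y: "y \<in> G T"
      show "y \<in> U"
      proof (rule ccontr)
        assume "y \<notin> U"
        with y D(3) Z obtain z where "z \<in> Z" "f z y \<in> c z" by (auto simp: G_def)
        moreover from this y have "f z y \<in> b z" by (auto simp: G_def T_def)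
        ultimately show False using fbc Z by blast
      qed
    qed
    ultimately show "\<exists>V\<in>G ` \<T>. x \<in> V \<and> V \<subseteq> U" by blast
  qed (use Gopen in auto)
  then have "weight Y \<le>o |G ` \<T>|" by (rule weight_le)
  also have "|G ` \<T>| \<le>o r"
    unfolding \<T>_def using r F countable_ordLeq_Cinfinite[OF \<B>(1) r]
    by (intro card_of_image_ordLeq card_of_finite_subsets_ordLeq card_of_Times_ordLeq_Cinfinite)
  finally show ?thesis .
qed

text \<open>A code is a finite cover by sets of a smallest base, each paired with an approximate
  value from a countable dense subset of the plane. Compactness gives every function a code, and two
  functions with a common code are uniformly \<open>e\<close>-close.\<close>

lemma uniform_net_le_weight:
  fixes \<Phi> :: "('a \<Rightarrow> complex) set"
  assumes Y: "compact_space Y" and w: "weight Y \<le>o r" and r: "Cinfinite r"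
    and cont: "\<And>f. f \<in> \<Phi> \<Longrightarrow> continuous_map Y euclidean f" and e: "e > 0"
  obtains \<Psi> where "\<Psi> \<subseteq> \<Phi>" "|\<Psi>| \<le>o r"
    "\<forall>f\<in>\<Phi>. \<exists>g\<in>\<Psi>. \<forall>y\<in>topspace Y. norm (f y - g y) \<le> e"
proof -
  obtain B where B: "base_of Y B" "weight Y = |B|" by (rule weight_attained)
  obtain D :: "complex set" where D: "countable D" "\<And>X. open X \<Longrightarrow> X \<noteq> {} \<Longrightarrow> \<exists>d\<in>D. d \<in> X"
    using countable_dense_setE by metis
  define \<T> where "\<T> = {T. T \<subseteq> B \<times> D \<and> finite T}"
  define R where "R f T \<longleftrightarrow> topspace Y \<subseteq> \<Union>(fst ` T) \<and> (\<forall>(V, c)\<in>T. \<forall>y\<in>V. norm (f y - c) \<le> e / 2)"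
    for f :: "'a \<Rightarrow> complex" and T
  have "\<exists>T\<in>\<T>. R f T" if f: "f \<in> \<Phi>" for f
  proof -
    have "\<exists>V\<in>B. \<exists>c\<in>D. y \<in> V \<and> (\<forall>z\<in>V. norm (f z - c) \<le> e / 2)" if y: "y \<in> topspace Y" for y
    proof -
      obtain c where c: "c \<in> D" "c \<in> ball (f y) (e / 4)"
        using D(2)[of "ball (f y) (e / 4)"] e by auto
      have "openin Y {z\<in>topspace Y. f z \<in> ball (f y) (e / 4)}"
        by (rule openin_continuous_map_preimage[OF cont[OF f]]) simp
      moreover have "y \<in> {z\<in>topspace Y. f z \<in> ball (f y) (e / 4)}" using y e by simp
      ultimately obtain V where V: "V \<in> B" "y \<in> V" "V \<subseteq> {z\<in>topspace Y. f z \<in> ball (f y) (e / 4)}"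
        using B(1) unfolding base_of_def by meson
      have "norm (f z - c) \<le> e / 2" if "z \<in> V" for z
      proof -
        have "dist (f y) (f z) < e / 4" "dist (f y) c < e / 4" using V(3) that c by auto
        then show ?thesis using dist_triangle3[of "f z" c "f y"] by (simp add: dist_norm norm_minus_commute)
      qed
      then show ?thesis using V c by blast
    qed
    then obtain V c where Vc: "\<And>y. y \<in> topspace Y \<Longrightarrow> V y \<in> B \<and> c y \<in> D \<and> y \<in> V y \<and>
        (\<forall>z\<in>V y. norm (f z - c y) \<le> e / 2)"
      by metis
    obtain C where C: "finite C" "C \<subseteq> V ` topspace Y" "topspace Y \<subseteq> \<Union>C"
      using Y[unfolded compact_space_def]
      by (rule compactin_subcover[where \<U>="V ` topspace Y"]) (use Vc B(1) in \<open>auto simp: base_of_def\<close>)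
    then obtain Z where Z: "finite Z" "Z \<subseteq> topspace Y" "C = V ` Z"
      by (meson finite_subset_image)
    then have "R f ((\<lambda>y. (V y, c y)) ` Z)" "(\<lambda>y. (V y, c y)) ` Z \<in> \<T>"
      using Vc C by (auto simp: R_def \<T>_def subset_iff)
    then show ?thesis by blast
  qed
  then obtain \<Psi> h where \<Psi>: "\<Psi> \<subseteq> \<Phi>" "\<Psi> \<subseteq> h ` \<T>"
      "\<forall>f\<in>\<Phi>. \<exists>g\<in>\<Psi>. \<exists>t\<in>\<T>. R f t \<and> R g t"
    by (rule net_from_codes) blast
  show thesis
  proof (rule that[OF \<Psi>(1)])
    have "|B| \<le>o r" using w B by simp
    then show "|\<Psi>| \<le>o r"
      using \<Psi>(2) r countable_ordLeq_Cinfinite[OF D(1) r] unfolding \<T>_def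
      by (elim card_of_subset_ordLeq) (intro card_of_image_ordLeq card_of_finite_subsets_ordLeq
          card_of_Times_ordLeq_Cinfinite)
  next
    show "\<forall>f\<in>\<Phi>. \<exists>g\<in>\<Psi>. \<forall>y\<in>topspace Y. norm (f y - g y) \<le> e"
    proof
      fix f assume "f \<in> \<Phi>"
      then obtain g T where g: "g \<in> \<Psi>" and T: "R f T" "R g T" using \<Psi>(3) by blast
      have "norm (f y - g y) \<le> e" if y: "y \<in> topspace Y" for y
      proof -
        have "y \<in> \<Union>(fst ` T)" using T(1) y unfolding R_def by blast
        then obtain V c where "(V, c) \<in> T" "y \<in> V" by auto
        then have "norm (f y - c) \<le> e / 2" "norm (g y - c) \<le> e / 2" using T by (auto simp: R_def)
        then show ?thesis using norm_triangle_ineq4[of "f y - c" "g y - c"] by simp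
      qed
      then show "\<exists>g\<in>\<Psi>. \<forall>y\<in>topspace Y. norm (f y - g y) \<le> e" using g by blast
    qed
  qed
qed

section \<open>Characters\<close>

text \<open>The circle is realised as the set of complex numbers of norm 1, where
  \<open>\<bar>t\<bar> \<le> 1/4\<close> turns into \<open>Re z \<ge> 0\<close>.\<close>

definition characters :: "('a :: topological_ab_group_add \<Rightarrow> complex) set" where
  "characters = {\<phi>. continuous_on UNIV \<phi> \<and> (\<forall>x. norm (\<phi> x) = 1) \<and> (\<forall>x y. \<phi> (x + y) = \<phi> x * \<phi> y)}"

definition polar :: "'a :: topological_ab_group_add set \<Rightarrow> ('a \<Rightarrow> complex) set" where
  "polar A = {\<phi>\<in>characters. \<forall>x\<in>A. Re (\<phi> x) \<ge> 0}"

section \<open>The group of characters and distances from 1 on the unit circle\<close>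

lemma charactersD:
  assumes "\<phi> \<in> characters"
  shows "continuous_on S \<phi>" "norm (\<phi> x) = 1" "\<phi> (x + y) = \<phi> x * \<phi> y"
  using assms continuous_on_subset[of UNIV \<phi> S] by (auto simp: characters_def)

lemma character_nonzero: "\<phi> \<in> characters \<Longrightarrow> \<phi> x \<noteq> 0"
  using charactersD(2)[of \<phi> x] by auto

lemma character_zero: "\<phi> \<in> characters \<Longrightarrow> \<phi> 0 = 1"
  using charactersD(3)[of \<phi> 0 0] character_nonzero[of \<phi> 0] by simp

lemma character_diff: "\<phi> \<in> characters \<Longrightarrow> \<phi> (x - y) = \<phi> x / \<phi> y"
  using charactersD(3)[of \<phi> "x - y" y] character_nonzero[of \<phi> y] by (simp add: field_simps)

lemma one_in_characters: "(\<lambda>x. 1) \<in> characters"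
  by (auto simp: characters_def)

lemma mult_in_characters:
  "\<phi> \<in> characters \<Longrightarrow> \<psi> \<in> characters \<Longrightarrow> (\<lambda>x. \<phi> x * \<psi> x) \<in> characters"
  by (auto simp: characters_def norm_mult intro!: continuous_intros)

lemma divide_in_characters:
  "\<phi> \<in> characters \<Longrightarrow> \<psi> \<in> characters \<Longrightarrow> (\<lambda>x. \<phi> x / \<psi> x) \<in> characters"
  using character_nonzero[of \<psi>]
  by (auto simp: characters_def norm_divide intro!: continuous_intros)

lemma power_in_characters: "\<phi> \<in> characters \<Longrightarrow> (\<lambda>x. \<phi> x ^ n) \<in> characters"
  by (auto simp: characters_def norm_power power_mult_distrib intro!: continuous_intros)

lemma norm_divide_minus_one:
  assumes "norm (w :: complex) = 1"
  shows "norm (z / w - 1) = norm (z - w)"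
proof -
  have "w \<noteq> 0" using assms by auto
  then have "z / w - 1 = (z - w) / w" by (simp add: field_simps)
  then show ?thesis using assms by (simp add: norm_divide)
qed

lemma norm_character_diff_minus_one:
  "\<phi> \<in> characters \<Longrightarrow> norm (\<phi> (x - y) - 1) = norm (\<phi> x - \<phi> y)"
  by (simp add: character_diff norm_divide_minus_one charactersD)

lemma Re_ge_norm_minus_one: "Re z \<ge> 1 - norm (z - 1)"
  using abs_Re_le_cmod[of "z - 1"] by auto

text \<open>Since \<open>z^2 - 1\<close> factors as \<open>(z - 1) * (z + 1)\<close> and
  \<open>norm (z + 1)\<close> is at least \<open>sqrt 2\<close> in the right half plane, each
  squaring that stays there gains a factor \<open>sqrt 2\<close>.\<close>

lemma norm_minus_one_le_doubling:
  fixes z :: complex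
  assumes "norm z = 1" "\<And>i. i < j \<Longrightarrow> Re (z ^ (2 ^ i)) \<ge> 0"
  shows "norm (z - 1) \<le> 2 / sqrt 2 ^ j"
  using assms
proof (induction j arbitrary: z)
  case 0
  then show ?case using norm_triangle_ineq4[of z 1] by simp
next
  case (Suc j)
  have "norm (z ^ 2 - 1) \<le> 2 / sqrt 2 ^ j"
  proof (rule Suc.IH)
    fix i assume "i < j"
    then show "Re ((z ^ 2) ^ (2 ^ i)) \<ge> 0"
      using Suc.prems(2)[of "Suc i"] by (simp add: power_mult[symmetric])
  qed (simp add: norm_power Suc.prems)
  moreover have "z ^ 2 - 1 = (z - 1) * (z + 1)" by (simp add: algebra_simps power2_eq_square)
  ultimately have *: "norm (z - 1) * norm (z + 1) \<le> 2 / sqrt 2 ^ j" by (simp add: norm_mult)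
  have "Re z \<ge> 0" using Suc.prems(2)[of 0] by simp
  moreover have "(Re z)\<^sup>2 + (Im z)\<^sup>2 = 1"
    using Suc.prems(1) by (simp add: cmod_def)
  ultimately have "2 \<le> (norm (z + 1))\<^sup>2"
    unfolding cmod_power2 by (simp add: power2_eq_square algebra_simps)
  then have "sqrt 2 \<le> norm (z + 1)" by (rule real_le_lsqrt[rotated 1]) auto
  then have "norm (z - 1) * sqrt 2 \<le> norm (z - 1) * norm (z + 1)"
    by (intro mult_left_mono) auto
  with * have "norm (z - 1) * sqrt 2 \<le> 2 / sqrt 2 ^ j" by linarith
  then show ?case by (simp add: field_simps)
qed

lemma norm_minus_one_small:
  assumes "e > 0"
  obtains j where "\<And>z :: complex. norm z = 1 \<Longrightarrow> (\<And>i. i < j \<Longrightarrow> Re (z ^ (2 ^ i)) \<ge> 0) \<Longrightarrow> norm (z - 1) \<le> e"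
proof -
  obtain j where j: "(1 / sqrt 2) ^ j < e / 2"
    using real_arch_pow_inv[of "e / 2" "1 / sqrt 2"] assms by auto
  show thesis
  proof (rule that)
    fix z :: complex assume "norm z = 1" "\<And>i. i < j \<Longrightarrow> Re (z ^ (2 ^ i)) \<ge> 0"
    then have "norm (z - 1) \<le> 2 / sqrt 2 ^ j" by (rule norm_minus_one_le_doubling)
    also have "\<dots> \<le> e" using j by (simp add: power_one_over field_simps)
    finally show "norm (z - 1) \<le> e" .
  qed
qed

text \<open>The closed right half of the circle contains no nontrivial subgroup: iterated squaring
  would bound the distance from 1 by half of itself.\<close>

lemma eq_one_if_powers_Re_nonneg:
  fixes z :: complex
  assumes "norm z = 1" "\<And>n. Re (z ^ n) \<ge> 0"
  shows "z = 1"
proof (rule ccontr)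
  assume "z \<noteq> 1"
  then have "norm (z - 1) / 2 > 0" by simp
  then obtain j where "\<And>w :: complex. norm w = 1 \<Longrightarrow> (\<And>i. i < j \<Longrightarrow> Re (w ^ (2 ^ i)) \<ge> 0) \<Longrightarrow>
      norm (w - 1) \<le> norm (z - 1) / 2"
    using norm_minus_one_small by blast
  then have "norm (z - 1) \<le> norm (z - 1) / 2" using assms by blast
  then show False using \<open>z \<noteq> 1\<close> by simp
qed

lemma character_funpow_double:
  "\<phi> \<in> characters \<Longrightarrow> \<phi> (((\<lambda>x. x + x) ^^ i) x) = \<phi> x ^ (2 ^ i)"
  by (induction i) (simp_all add: charactersD power_add[symmetric] mult_2[symmetric])

section \<open>From the circle of cosets to the complex unit circle\<close>

lemma Re_cis_nonneg_iff:
  assumes "-1/2 \<le> t" "t < 1/2"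
  shows "Re (cis (2 * pi * t)) \<ge> 0 \<longleftrightarrow> \<bar>t\<bar> \<le> 1/4"
proof -
  have "cos (2 * pi * t) = cos (2 * pi * \<bar>t\<bar>)" by (simp add: abs_if)
  moreover have "cos (2 * pi * \<bar>t\<bar>) \<ge> 0" if "\<bar>t\<bar> \<le> 1/4"
    using that cos_ge_zero[of "2 * pi * \<bar>t\<bar>"] pi_gt_zero mult_left_mono[of "\<bar>t\<bar>" "1/4" "2 * pi"]
    by (simp add: order_trans[of "- (pi / 2)" 0])
  moreover have "cos (2 * pi * \<bar>t\<bar>) < 0" if "\<bar>t\<bar> > 1/4"
    using that assms cos_monotone_0_pi[of "pi / 2" "2 * pi * \<bar>t\<bar>"] by (auto simp: field_simps)
  ultimately show ?thesis by (auto simp: not_le[symmetric])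
qed

lemma circle_coset_rep:
  fixes c :: "real set"
  assumes "c \<in> range (\<lambda>x. x +o \<int>)"
  obtains t where "c = t +o \<int>" "-1/2 \<le> t" "t < 1/2"
proof -
  obtain s where s: "c = s +o \<int>" using assms by auto
  define n where "n = \<lfloor>s + 1/2\<rfloor>"
  have "(s - of_int n) +o \<int> = s +o (\<int> :: real set)"
  proof (intro set_eqI iffI)
    fix x assume "x \<in> (s - of_int n) +o \<int>"
    then obtain m where "x = s - of_int n + of_int m" by (auto simp: elt_set_plus_def Ints_def)
    then have "x = s + of_int (m - n)" by simp
    then show "x \<in> s +o \<int>" by (simp only: set_plus_intro2 Ints_of_int)
  next
    fix x assume "x \<in> s +o \<int>"
    then obtain m where "x = s + of_int m" by (auto simp: elt_set_plus_def Ints_def)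
    then have "x = s - of_int n + of_int (m + n)" by simp
    then show "x \<in> (s - of_int n) +o \<int>" by (simp only: set_plus_intro2 Ints_of_int)
  qed
  moreover have "-1/2 \<le> s - of_int n" "s - of_int n < 1/2"
    unfolding n_def by linarith+
  ultimately show thesis using that s by metis
qed

text \<open>An arbitrary representative serves, because \<open>cis\<close> has period
  \<open>2 * pi\<close> and the members of a coset differ by integers.\<close>

definition circle_embed :: "real set \<Rightarrow> complex" where
  "circle_embed c = cis (2 * pi * (SOME t. t \<in> c))"

lemma circle_embed: "circle_embed (t +o \<int>) = cis (2 * pi * t)"
proof -
  have "t \<in> t +o \<int>" unfolding elt_set_plus_def using Ints_0 by force
  then have "(SOME s. s \<in> t +o \<int>) \<in> t +o \<int>" by (rule someI)
  then obtain n where "(SOME s. s \<in> t +o \<int>) = t + of_int n" by (auto simp: elt_set_plus_def Ints_def)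
  then have "circle_embed (t +o \<int>) = cis (2 * pi * t + 2 * pi * of_int n)"
    by (simp add: circle_embed_def algebra_simps)
  also have "\<dots> = cis (2 * pi * t)" by (simp add: cis_mult[symmetric])
  finally show ?thesis .
qed

text \<open>Continuity passes through the quotient topology: an open set of the plane pulls back to
  an open set of reals along \<open>cis\<close>. The bound \<open>1/4\<close> becomes nonnegativity
  of the real part on the representative in \<open>[-1/2, 1/2)\<close>.\<close>

lemma circle_embed_dual_group:
  assumes "\<psi> \<in> dual_group"
  shows "(\<lambda>x. circle_embed (\<psi> x)) \<in> characters"
    and "Re (circle_embed (\<psi> x)) \<ge> 0 \<longleftrightarrow> circle_abs (\<psi> x) \<le> 1/4"
proof -
  have cont: "continuous_map euclidean (quotient_space \<int>) \<psi>"
    and hom: "\<And>x y. \<psi> (x + y) = \<psi> x + \<psi> y"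
    using assms by (auto simp: dual_group_def)
  have rng: "\<psi> x \<in> range (\<lambda>t. t +o \<int>)" for x
    using continuous_map_image_subset_topspace[OF cont] by (auto simp: topspace_quotient_space)
  have "open ((\<lambda>x. circle_embed (\<psi> x)) -` U)" if "open U" for U
  proof -
    let ?V = "{c \<in> range (\<lambda>t. t +o \<int>). circle_embed c \<in> U}"
    have "{t. t +o \<int> \<in> ?V} = (\<lambda>t. cis (2 * pi * t)) -` U" by (auto simp: circle_embed)
    moreover have "open ((\<lambda>t. cis (2 * pi * t)) -` U)"
      by (intro open_vimage that continuous_intros)
    ultimately have "openin (quotient_space \<int>) ?V" by (auto simp: openin_quotient_space)
    then have "openin euclidean {x \<in> topspace euclidean. \<psi> x \<in> ?V}"
      by (rule openin_continuous_map_preimage[OF cont])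
    moreover have "{x \<in> topspace euclidean. \<psi> x \<in> ?V} = (\<lambda>x. circle_embed (\<psi> x)) -` U"
      using rng by auto
    ultimately show ?thesis by simp
  qed
  then have "continuous_on UNIV (\<lambda>x. circle_embed (\<psi> x))"
    by (simp add: continuous_on_open_vimage)
  moreover have "norm (circle_embed (\<psi> x)) = 1" for x
    by (simp add: circle_embed_def)
  moreover have "circle_embed (\<psi> (x + y)) = circle_embed (\<psi> x) * circle_embed (\<psi> y)" for x y
  proof -
    obtain s where s: "\<psi> x = s +o \<int>" using rng[of x] by auto
    obtain t where t: "\<psi> y = t +o \<int>" using rng[of y] by auto
    show ?thesis unfolding hom s t circle_add circle_embed cis_mult by (simp add: algebra_simps)
  qed
  ultimately show "(\<lambda>x. circle_embed (\<psi> x)) \<in> characters" by (simp add: characters_def)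
  obtain t where t: "\<psi> x = t +o \<int>" "-1/2 \<le> t" "t < 1/2" using circle_coset_rep[OF rng[of x]] .
  then show "Re (circle_embed (\<psi> x)) \<ge> 0 \<longleftrightarrow> circle_abs (\<psi> x) \<le> 1/4"
    using Re_cis_nonneg_iff[OF t(2,3)] by (simp only: circle_embed circle_abs)
qed

text \<open>The nontrivial half of the bipolar identity: a quasiconvex set can be recovered from its
  polar.\<close>

lemma quasiconvex_separated:
  assumes "quasiconvex A" "g \<notin> A"
  shows "\<exists>\<phi>\<in>polar A. Re (\<phi> g) < 0"
proof -
  obtain \<psi> where \<psi>: "\<psi> \<in> dual_group" "\<forall>a\<in>A. circle_abs (\<psi> a) \<le> 1/4" "circle_abs (\<psi> g) > 1/4"
    using assms unfolding quasiconvex_def by blast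
  have "(\<lambda>x. circle_embed (\<psi> x)) \<in> polar A" "\<not> Re (circle_embed (\<psi> g)) \<ge> 0"
    using circle_embed_dual_group[OF \<psi>(1)] \<psi>(2,3) by (auto simp: polar_def)
  then show ?thesis by (meson not_le)
qed

text \<open>A finite product of circles is totally bounded: the codes are the functions from
  \<open>I\<close> into a finite \<open>e / 2\<close>-net of the circle. The index set is arbitrary,
  so the lemma serves for characters on finitely many points as well as for points evaluated at
  finitely many characters.\<close>

lemma finite_net:
  fixes \<Phi> :: "('i \<Rightarrow> complex) set"
  assumes I: "finite I" and e: "e > 0" and norm: "\<And>f i. f \<in> \<Phi> \<Longrightarrow> i \<in> I \<Longrightarrow> norm (f i) = 1"
  obtains \<Psi> where "finite \<Psi>" "\<Psi> \<subseteq> \<Phi>" "\<forall>f\<in>\<Phi>. \<exists>g\<in>\<Psi>. \<forall>i\<in>I. norm (f i - g i) \<le> e"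
proof -
  have "compact (sphere (0::complex) 1)" by simp
  then obtain Z where Z: "finite Z" "sphere (0::complex) 1 \<subseteq> (\<Union>c\<in>Z. ball c (e / 2))"
    using e unfolding compact_eq_totally_bounded by (meson half_gt_zero)
  define R where "R f t \<longleftrightarrow> (\<forall>i\<in>I. norm (f i - t i) \<le> e / 2)" for f t :: "'i \<Rightarrow> complex"
  have "\<exists>t\<in>I \<rightarrow>\<^sub>E Z. R f t" if f: "f \<in> \<Phi>" for f
  proof -
    have "\<exists>c\<in>Z. norm (f i - c) \<le> e / 2" if "i \<in> I" for i
      using Z(2) norm[OF f that] by (force simp: dist_norm norm_minus_commute)
    then obtain c where "\<And>i. i \<in> I \<Longrightarrow> c i \<in> Z \<and> norm (f i - c i) \<le> e / 2" by metis
    then show ?thesis by (intro bexI[of _ "restrict c I"]) (auto simp: R_def)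
  qed
  then obtain \<Psi> h where \<Psi>: "\<Psi> \<subseteq> \<Phi>" "\<Psi> \<subseteq> h ` (I \<rightarrow>\<^sub>E Z)"
      "\<forall>f\<in>\<Phi>. \<exists>g\<in>\<Psi>. \<exists>t\<in>I \<rightarrow>\<^sub>E Z. R f t \<and> R g t"
    by (rule net_from_codes) blast
  show thesis
  proof (rule that)
    show "finite \<Psi>" using \<Psi>(2) I Z(1) by (meson finite_PiE finite_imageI finite_subset)
    show "\<forall>f\<in>\<Phi>. \<exists>g\<in>\<Psi>. \<forall>i\<in>I. norm (f i - g i) \<le> e"
    proof
      fix f assume "f \<in> \<Phi>"
      then obtain g t where g: "g \<in> \<Psi>" "R f t" "R g t" using \<Psi>(3) by blast
      have "norm (f i - g i) \<le> e" if "i \<in> I" for i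
      proof -
        have "norm (f i - t i) \<le> e / 2" "norm (g i - t i) \<le> e / 2" using g that by (auto simp: R_def)
        then show ?thesis using norm_triangle_ineq4[of "f i - t i" "g i - t i"] by simp
      qed
      then show "\<exists>g\<in>\<Psi>. \<forall>i\<in>I. norm (f i - g i) \<le> e" using g by blast
    qed
  qed (fact \<Psi>(1))
qed

section \<open>Totally bounded sets of characters\<close>

lemma open_vimage_minus:
  fixes W :: "'a :: topological_ab_group_add set"
  assumes "open W"
  shows "open ((\<lambda>x. x - y) -` W)"
proof -
  have "continuous_on UNIV (\<lambda>x. x + - y)"
    by (intro continuous_on_add continuous_on_id continuous_on_const)
  then show ?thesis using assms by (intro open_vimage) auto
qed

lemma compact_translation:
  fixes C :: "'a :: topological_ab_group_add set"
  assumes "compact C"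
  shows "compact ((\<lambda>x. y + x) ` C)"
  by (intro compact_continuous_image continuous_on_add continuous_on_id continuous_on_const assms)

lemma continuous_on_funpow_double:
  "continuous_on UNIV ((\<lambda>x :: 'a :: topological_ab_group_add. x + x) ^^ i)"
proof (induction i)
  case (Suc i)
  then show ?case
    by (auto simp: o_def intro!: continuous_on_add)
qed (simp add: id_def)

text \<open>Uniform distance at most \<open>e\<close>, phrased as a relation so that no supremum
  over \<open>C\<close> has to be formed.\<close>

definition near :: "'a set \<Rightarrow> real \<Rightarrow> ('a \<Rightarrow> complex) \<Rightarrow> ('a \<Rightarrow> complex) \<Rightarrow> bool" where
  "near C e f g \<longleftrightarrow> (\<forall>x\<in>C. norm (f x - g x) \<le> e)"

lemma near_refl: "e \<ge> 0 \<Longrightarrow> near C e f f"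
  by (simp add: near_def)

lemma near_sym: "near C e f g \<longleftrightarrow> near C e g f"
  by (simp add: near_def norm_minus_commute)

lemma near_trans: "near C d f g \<Longrightarrow> near C e g h \<Longrightarrow> d + e \<le> c \<Longrightarrow> near C c f h"
  unfolding near_def by (smt (verit) norm_diff_triangle_ineq norm_triangle_ineq4 norm_diff_triangle_le)

lemma near_mono: "near C d f g \<Longrightarrow> C' \<subseteq> C \<Longrightarrow> d \<le> e \<Longrightarrow> near C' e f g"
  unfolding near_def by force

lemma near_mult_characters:
  assumes "near C d f f'" "near C e g g'" "g \<in> characters" "f' \<in> characters" "d + e \<le> c"
  shows "near C c (\<lambda>x. f x * g x) (\<lambda>x. f' x * g' x)"
  unfolding near_def
proof
  fix x assume x: "x \<in> C"
  have "f x * g x - f' x * g' x = (f x - f' x) * g x + f' x * (g x - g' x)"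
    by (simp add: algebra_simps)
  also have "norm \<dots> \<le> norm ((f x - f' x) * g x) + norm (f' x * (g x - g' x))"
    by (rule norm_triangle_ineq)
  also have "\<dots> = norm (f x - f' x) + norm (g x - g' x)"
    using assms(3,4) by (simp add: norm_mult charactersD)
  also have "\<dots> \<le> c" using assms(1,2,5) x by (force simp: near_def)
  finally show "norm (f x * g x - f' x * g' x) \<le> c" .
qed

lemma near_divide_character:
  assumes "near C e f f'" "g \<in> characters"
  shows "near C e (\<lambda>x. f x / g x) (\<lambda>x. f' x / g x)"
  using assms by (simp add: near_def diff_divide_distrib[symmetric] norm_divide charactersD)

text \<open>By Zorn's lemma there is a maximal \<open>e\<close>-separated subset; it is also an
  \<open>e\<close>-net, since a point far from all its members could be added.\<close>

lemma exists_maximal_separated: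
  assumes "e \<ge> 0"
  obtains S where "S \<subseteq> \<Phi>" "\<forall>f\<in>S. \<forall>g\<in>S. near C e f g \<longrightarrow> f = g" "\<forall>f\<in>\<Phi>. \<exists>g\<in>S. near C e f g"
proof -
  define \<A> where "\<A> = {S. S \<subseteq> \<Phi> \<and> (\<forall>f\<in>S. \<forall>g\<in>S. near C e f g \<longrightarrow> f = g)}"
  have chain: "\<Union>\<C> \<in> \<A>" if "subset.chain \<A> \<C>" for \<C>
    unfolding \<A>_def
  proof (intro CollectI conjI ballI impI)
    show "\<Union>\<C> \<subseteq> \<Phi>" using that by (auto simp: subset.chain_def \<A>_def)
    fix f g assume "f \<in> \<Union>\<C>" "g \<in> \<Union>\<C>" "near C e f g"
    then obtain S T where ST: "S \<in> \<C>" "f \<in> S" "T \<in> \<C>" "g \<in> T" by auto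
    moreover have "\<C> \<subseteq> \<A>" "\<forall>S\<in>\<C>. \<forall>T\<in>\<C>. S \<subseteq> T \<or> T \<subseteq> S"
      using that by (auto simp: subset.chain_def)
    ultimately obtain R where "R \<in> \<A>" "f \<in> R" "g \<in> R" by blast
    then show "f = g" using \<open>near C e f g\<close> by (auto simp: \<A>_def)
  qed
  have "\<exists>S\<in>\<A>. \<forall>T\<in>\<A>. S \<subseteq> T \<longrightarrow> T = S"
    using chain by (rule subset_Zorn')
  then obtain S where S: "S \<in> \<A>" "\<forall>T\<in>\<A>. S \<subseteq> T \<longrightarrow> T = S" by blast
  show thesis
  proof (rule that)
    show "\<forall>f\<in>\<Phi>. \<exists>g\<in>S. near C e f g"
    proof (rule ccontr)
      assume "\<not> ?thesis"
      then obtain f where f: "f \<in> \<Phi>" "\<And>g. g \<in> S \<Longrightarrow> \<not> near C e f g" by blast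
      then have f': "\<not> near C e f g" "\<not> near C e g f" if "g \<in> S" for g
        using that near_sym[of C e f g] by auto
      have "insert f S \<subseteq> \<Phi>" "\<forall>g\<in>S. \<forall>h\<in>S. near C e g h \<longrightarrow> g = h"
        using S(1) f(1) by (simp_all add: \<A>_def)
      then have "insert f S \<in> \<A>" using f' unfolding \<A>_def by fast
      then have "f \<in> S" using S(2) by blast
      then show False using f(2) near_refl[OF assms] by blast
    qed
  qed (use S(1) in \<open>auto simp: \<A>_def\<close>)
qed

text \<open>A normalised decomposition: the compact sets increase and contain \<open>0\<close>.
  Quasiconvex neighbourhoods \<open>V\<close> are given together with an open \<open>N\<close>
  inside them, as \<open>V\<close> itself may fail to be open.\<close>

locale k_omega_group =
  fixes K :: "nat \<Rightarrow> 'a :: {topological_ab_group_add, t2_space} set"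
  assumes compact_K: "compact (K n)"
    and mono_K: "m \<le> n \<Longrightarrow> K m \<subseteq> K n"
    and zero_in_K: "0 \<in> K n"
    and compact_subset_K: "compact L \<Longrightarrow> \<exists>n. L \<subseteq> K n"
    and openI_K: "(\<And>n. \<exists>V. open V \<and> U \<inter> K n = V \<inter> K n) \<Longrightarrow> open U"
    and lqc: "open (W :: 'a set) \<Longrightarrow> 0 \<in> W \<Longrightarrow> \<exists>V N. open N \<and> 0 \<in> N \<and> N \<subseteq> V \<and> V \<subseteq> W \<and> quasiconvex V"
begin

text \<open>The finite centres may be any characters and need not lie in \<open>P\<close>.\<close>

definition tb :: "('a \<Rightarrow> complex) set \<Rightarrow> bool" where
  "tb P \<longleftrightarrow> P \<subseteq> characters \<and>
     (\<forall>n. \<forall>e>0. \<exists>F. finite F \<and> F \<subseteq> characters \<and> (\<forall>\<phi>\<in>P. \<exists>f\<in>F. near (K n) e \<phi> f))"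

text \<open>A decreasing sequence of neighbourhoods of the trivial character for uniform convergence
  on compact sets: the set \<open>K n\<close> grows while the radius shrinks.\<close>

definition unit_ball :: "nat \<Rightarrow> ('a \<Rightarrow> complex) set" where
  "unit_ball n = {\<phi>\<in>characters. near (K n) (1 / (real n + 1)) \<phi> (\<lambda>x. 1)}"

section \<open>Stability of total boundedness, and its interplay with separated sets\<close>

lemma in_some_K: "\<exists>n. x \<in> K n"
  using compact_subset_K[of "{x}"] by auto

lemma tbD:
  assumes "tb P" "e > 0"
  shows "\<exists>F. finite F \<and> F \<subseteq> characters \<and> (\<forall>\<phi>\<in>P. \<exists>f\<in>F. near (K n) e \<phi> f)"
  using assms unfolding tb_def by blast

lemma tb_subset: "tb P \<Longrightarrow> Q \<subseteq> P \<Longrightarrow> tb Q"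
  unfolding tb_def by (meson subset_iff)

lemma tb_finite_Union:
  assumes "finite I" "\<And>i. i \<in> I \<Longrightarrow> tb (P i)"
  shows "tb (\<Union>i\<in>I. P i)"
  unfolding tb_def
proof (intro conjI allI impI)
  show "(\<Union>i\<in>I. P i) \<subseteq> characters" using assms(2) by (auto simp: tb_def)
  fix n and e :: real assume e: "e > 0"
  have "\<exists>F. finite F \<and> F \<subseteq> characters \<and> (\<forall>\<phi>\<in>P i. \<exists>f\<in>F. near (K n) e \<phi> f)" if "i \<in> I" for i
    using assms(2)[OF that] e unfolding tb_def by blast
  then obtain F where F: "\<And>i. i \<in> I \<Longrightarrow> finite (F i) \<and> F i \<subseteq> characters \<and> (\<forall>\<phi>\<in>P i. \<exists>f\<in>F i. near (K n) e \<phi> f)"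
    by metis
  have "finite (\<Union>i\<in>I. F i)" using assms(1) F by blast
  moreover have "(\<Union>i\<in>I. F i) \<subseteq> characters" using F by blast
  moreover have "\<exists>f\<in>\<Union>i\<in>I. F i. near (K n) e \<phi> f" if \<phi>: "\<phi> \<in> (\<Union>i\<in>I. P i)" for \<phi>
  proof -
    obtain i where i: "i \<in> I" "\<phi> \<in> P i" using \<phi> by blast
    then obtain f where "f \<in> F i" "near (K n) e \<phi> f" using F[OF i(1)] by auto
    then show ?thesis using i(1) by (intro bexI[of _ f] UN_I)
  qed
  ultimately show "\<exists>F. finite F \<and> F \<subseteq> characters \<and> (\<forall>\<phi>\<in>\<Union>i\<in>I. P i. \<exists>f\<in>F. near (K n) e \<phi> f)"
    by (intro exI[of _ "\<Union>i\<in>I. F i"] conjI ballI)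
qed

text \<open>Dividing by a fixed character is an isometry for every distance, so finite nets are
  carried to finite nets.\<close>

lemma tb_divide:
  assumes P: "tb P" and g: "g \<in> characters"
  shows "tb ((\<lambda>\<phi> x. \<phi> x / g x) ` P)"
  unfolding tb_def
proof (intro conjI allI impI)
  show "(\<lambda>\<phi> x. \<phi> x / g x) ` P \<subseteq> characters"
    using P g by (auto simp: tb_def divide_in_characters subset_iff)
  fix n and e :: real assume "e > 0"
  then obtain F where F: "finite F" "F \<subseteq> characters" "\<forall>\<phi>\<in>P. \<exists>f\<in>F. near (K n) e \<phi> f"
    using tbD[OF P, of e n] by blast
  have "\<exists>f\<in>(\<lambda>f x. f x / g x) ` F. near (K n) e \<phi> f" if "\<phi> \<in> (\<lambda>\<phi> x. \<phi> x / g x) ` P" for \<phi>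
    using that F(3) near_divide_character[OF _ g] by blast
  moreover have "finite ((\<lambda>f x. f x / g x) ` F)" "(\<lambda>f x. f x / g x) ` F \<subseteq> characters"
    using F g by (auto simp: divide_in_characters subset_iff)
  ultimately show "\<exists>F. finite F \<and> F \<subseteq> characters \<and>
      (\<forall>\<phi>\<in>(\<lambda>\<phi> x. \<phi> x / g x) ` P. \<exists>f\<in>F. near (K n) e \<phi> f)" by blast
qed

text \<open>Moves the centres into a prescribed dense set \<open>D\<close>: given centres are first
  replaced by members of \<open>P\<close> near them, and these by members of \<open>D\<close>. Three
  errors of \<open>e / 3\<close> add up.\<close>

lemma tb_centres:
  assumes P: "tb P" and e: "e > 0"
    and D: "\<And>\<phi>. \<phi> \<in> P \<Longrightarrow> \<exists>d\<in>D. near (K n) (e / 3) \<phi> d"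
  obtains F where "finite F" "F \<subseteq> D" "\<forall>\<phi>\<in>P. \<exists>f\<in>F. near (K n) e \<phi> f"
proof -
  obtain F where F: "finite F" "\<forall>\<phi>\<in>P. \<exists>f\<in>F. near (K n) (e / 3) \<phi> f"
    using tbD[OF P, of "e / 3" n] e by auto
  define R where "R \<phi> f \<longleftrightarrow> near (K n) (e / 3) \<phi> f" for \<phi> f
  obtain \<Psi> h where \<Psi>: "\<Psi> \<subseteq> P" "\<Psi> \<subseteq> h ` F" "\<forall>\<phi>\<in>P. \<exists>\<psi>\<in>\<Psi>. \<exists>f\<in>F. R \<phi> f \<and> R \<psi> f"
    using net_from_codes[of P F R] F(2) unfolding R_def by blast
  obtain d where d: "\<And>\<phi>. \<phi> \<in> P \<Longrightarrow> d \<phi> \<in> D \<and> near (K n) (e / 3) \<phi> (d \<phi>)" using D by metis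
  show thesis
  proof (rule that)
    show "finite (d ` \<Psi>)" using \<Psi>(2) F(1) by (meson finite_imageI finite_subset)
    show "d ` \<Psi> \<subseteq> D" using d \<Psi>(1) by auto
    show "\<forall>\<phi>\<in>P. \<exists>f\<in>d ` \<Psi>. near (K n) e \<phi> f"
    proof
      fix \<phi> assume "\<phi> \<in> P"
      then obtain \<psi> f where \<psi>: "\<psi> \<in> \<Psi>" "near (K n) (e / 3) \<phi> f" "near (K n) (e / 3) \<psi> f"
        using \<Psi>(3) unfolding R_def by blast
      then have "near (K n) (2 * e / 3) \<phi> \<psi>"
        using near_trans[of "K n" "e / 3" \<phi> f "e / 3" \<psi>] near_sym[of "K n" _ \<psi>] by simp
      then have "near (K n) e \<phi> (d \<psi>)"
        using near_trans[of "K n" "2 * e / 3" \<phi> \<psi> "e / 3" "d \<psi>"] d \<psi>(1) \<Psi>(1) by auto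
      then show "\<exists>f\<in>d ` \<Psi>. near (K n) e \<phi> f" using \<psi>(1) by blast
    qed
  qed
qed

text \<open>Two members of \<open>P\<close> with a common centre at distance \<open>e / 2\<close>
  are \<open>e\<close>-close, so points of a separated set need different centres.\<close>

lemma tb_Int_separated_finite:
  assumes P: "tb P" and e: "e > 0"
    and S: "\<forall>f\<in>S. \<forall>g\<in>S. near (K n) e f g \<longrightarrow> f = g"
  shows "finite (P \<inter> S)"
proof -
  obtain F where F: "finite F" "\<forall>\<phi>\<in>P. \<exists>f\<in>F. near (K n) (e / 2) \<phi> f"
    using tbD[OF P, of "e / 2" n] e by auto
  then obtain c where c: "\<And>\<phi>. \<phi> \<in> P \<Longrightarrow> c \<phi> \<in> F \<and> near (K n) (e / 2) \<phi> (c \<phi>)" by metis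
  have "inj_on c (P \<inter> S)"
  proof (rule inj_onI)
    fix f g assume fg: "f \<in> P \<inter> S" "g \<in> P \<inter> S" "c f = c g"
    then have "near (K n) (e / 2) f (c f)" "near (K n) (e / 2) (c f) g"
      using c[of f] c[of g] near_sym[of "K n" "e / 2" g] by auto
    then have "near (K n) e f g" by (rule near_trans) simp
    then show "f = g" using S fg by blast
  qed
  moreover have "c ` (P \<inter> S) \<subseteq> F" using c by auto
  ultimately show ?thesis using F(1) by (meson finite_imageD finite_subset)
qed

text \<open>Late sets \<open>F k\<close> are uniformly close to the trivial character, so this
  character together with the finitely many early elements is a net.\<close>

lemma tb_Union_null_sequence:
  assumes "\<And>n. finite (F n)" "\<And>n. F n \<subseteq> unit_ball n"
  shows "tb (\<Union>n. F n)"
  unfolding tb_def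
proof (intro conjI allI impI)
  show "(\<Union>n. F n) \<subseteq> characters" using assms(2) by (auto simp: unit_ball_def)
  fix n and e :: real assume "e > 0"
  then obtain m where m: "1 / (real m + 1) < e"
    using reals_Archimedean[of e] by (auto simp: inverse_eq_divide add.commute)
  \<comment> \<open>Beyond \<open>N\<close> the radius is at most \<open>e\<close>, by
    \<open>m\<close>, and \<open>K k\<close> contains \<open>K n\<close>.\<close>
  define N where "N = max m n"
  define F' where "F' = insert (\<lambda>x. 1) (\<Union>k<N. F k)"
  have N: "1 / (real k + 1) \<le> e" if "N \<le> k" for k
  proof -
    have "1 / (real k + 1) \<le> 1 / (real m + 1)"
      using that by (intro divide_left_mono) (auto simp: N_def)
    then show ?thesis using m by linarith
  qed
  have "\<exists>f\<in>F'. near (K n) e \<phi> f" if \<phi>: "\<phi> \<in> F k" for \<phi> k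
  proof (cases "k < N")
    case True
    then show ?thesis using \<phi> near_refl[of e "K n" \<phi>] \<open>e > 0\<close> by (auto simp: F'_def)
  next
    case False
    then have "near (K k) (1 / (real k + 1)) \<phi> (\<lambda>x. 1)" using \<phi> assms(2) by (auto simp: unit_ball_def)
    then have "near (K n) e \<phi> (\<lambda>x. 1)"
      by (rule near_mono[OF _ mono_K N]) (use False in \<open>auto simp: N_def\<close>)
    then show ?thesis by (auto simp: F'_def)
  qed
  moreover have "finite F'" using assms(1) by (simp add: F'_def)
  moreover have "F' \<subseteq> characters"
    using assms(2) one_in_characters by (fastforce simp: F'_def unit_ball_def)
  ultimately show "\<exists>F'. finite F' \<and> F' \<subseteq> characters \<and> (\<forall>\<phi>\<in>\<Union>n. F n. \<exists>f\<in>F'. near (K n) e \<phi> f)"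
    by blast
qed

text \<open>A totally bounded set of characters is equicontinuous on every \<^term>\<open>K n\<close>.\<close>

lemma tb_imp_polar_nbhd:
  assumes "tb P"
  obtains W where "open W" "0 \<in> W" "P \<subseteq> polar W"
proof -
  \<comment> \<open>The margin \<open>d\<close>, uniform over \<open>P\<close>, makes the trace of
    \<open>W\<close> on each \<open>K n\<close> open: a finite net controls the change by
    \<open>3 * d / 4\<close> and leaves the margin \<open>d / 4\<close>.\<close>
  define W where "W = {x. \<exists>d>0. \<forall>\<phi>\<in>P. Re (\<phi> x) \<ge> d}"
  have PX: "P \<subseteq> characters" using assms by (simp add: tb_def)
  have "open W"
  proof (rule openI_K)
    fix n
    have "\<exists>V. open V \<and> x \<in> V \<and> V \<inter> K n \<subseteq> W" if x: "x \<in> W \<inter> K n" for x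
    proof -
      obtain d where d: "d > 0" "\<And>\<phi>. \<phi> \<in> P \<Longrightarrow> Re (\<phi> x) \<ge> d" using x by (auto simp: W_def)
      obtain F where F: "finite F" "F \<subseteq> characters" "\<forall>\<phi>\<in>P. \<exists>f\<in>F. near (K n) (d / 4) \<phi> f"
        using tbD[OF assms, of "d / 4" n] d(1) by auto
      define V where "V = (\<Inter>f\<in>F. f -` ball (f x) (d / 4))"
      have "open V" unfolding V_def
        using F(1,2) by (intro open_INT ballI open_vimage) (simp_all add: charactersD(1) subset_iff)
      moreover have "x \<in> V" using d(1) by (simp add: V_def)
      moreover have "y \<in> W" if y: "y \<in> V \<inter> K n" for y
      proof -
        have "Re (\<phi> y) \<ge> d / 4" if \<phi>: "\<phi> \<in> P" for \<phi>
        proof -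
          obtain f where f: "f \<in> F" "near (K n) (d / 4) \<phi> f" using F(3) \<phi> by blast
          have "norm (\<phi> x - f x) \<le> d / 4" "norm (\<phi> y - f y) \<le> d / 4"
            using f(2) x y by (auto simp: near_def)
          moreover have "norm (f x - f y) < d / 4" using y f(1) by (auto simp: V_def dist_norm)
          moreover have "\<phi> x - \<phi> y = (\<phi> x - f x) + (f x - f y) - (\<phi> y - f y)" by simp
          ultimately have "norm (\<phi> x - \<phi> y) \<le> 3 * d / 4"
            using norm_triangle_ineq4[of "(\<phi> x - f x) + (f x - f y)" "\<phi> y - f y"]
              norm_triangle_ineq[of "\<phi> x - f x" "f x - f y"] by simp
          then have "\<bar>Re (\<phi> x) - Re (\<phi> y)\<bar> \<le> 3 * d / 4"
            using abs_Re_le_cmod[of "\<phi> x - \<phi> y"] by simp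
          then show ?thesis using d(2)[OF \<phi>] by linarith
        qed
        then show ?thesis using d(1) by (auto simp: W_def intro!: exI[of _ "d / 4"])
      qed
      ultimately show ?thesis by blast
    qed
    then obtain V where V: "\<And>x. x \<in> W \<inter> K n \<Longrightarrow> open (V x) \<and> x \<in> V x \<and> V x \<inter> K n \<subseteq> W" by metis
    then have "open (\<Union>x\<in>W \<inter> K n. V x)" "W \<inter> K n = (\<Union>x\<in>W \<inter> K n. V x) \<inter> K n" by blast+
    then show "\<exists>V. open V \<and> W \<inter> K n = V \<inter> K n" by blast
  qed
  moreover have "0 \<in> W"
  proof -
    have "Re (\<phi> 0) \<ge> 1" if "\<phi> \<in> P" for \<phi> using character_zero[of \<phi>] PX that by auto
    then show ?thesis unfolding W_def using zero_less_one by blast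
  qed
  moreover have "P \<subseteq> polar W" using PX by (fastforce simp: polar_def W_def)
  ultimately show thesis by (rule that)
qed

text \<open>An Arzela-Ascoli argument. On a small neighbourhood \<open>V\<close> all characters of
  the polar are close to 1; finitely many translates of \<open>V\<close> cover \<open>K n\<close>,
  so closeness on the finite set \<open>Y\<close> of centres spreads to \<open>K n\<close>.\<close>

lemma tb_polar:
  assumes W: "open W" "0 \<in> W"
  shows "tb (polar W)"
  unfolding tb_def
proof (intro conjI allI impI)
  show "polar W \<subseteq> characters" by (auto simp: polar_def)
  fix n and e :: real assume e: "e > 0"
  then obtain j where j: "\<And>z :: complex. norm z = 1 \<Longrightarrow> (\<And>i. i < j \<Longrightarrow> Re (z ^ (2 ^ i)) \<ge> 0) \<Longrightarrow> norm (z - 1) \<le> e / 3"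
    using norm_minus_one_small[of "e / 3"] by auto
  \<comment> \<open>The points whose first \<open>j\<close> iterated doublings, starting with the
    point itself, stay in \<open>W\<close>; there \<open>norm_minus_one_small\<close> applies to
    every character of the polar.\<close>
  define V :: "'a set" where "V = (\<Inter>i<j. ((\<lambda>x. x + x) ^^ i) -` W)"
  have V: "open V" unfolding V_def
    by (intro open_INT ballI open_vimage W continuous_on_funpow_double) simp
  have "((\<lambda>x. x + x) ^^ i) 0 = (0 :: 'a)" for i by (induction i) auto
  then have V0: "0 \<in> V" using W(2) by (simp add: V_def)
  have small: "norm (\<phi> x - 1) \<le> e / 3" if \<phi>: "\<phi> \<in> polar W" and x: "x \<in> V" for \<phi> x
  proof (rule j)
    show "norm (\<phi> x) = 1" using \<phi> by (auto simp: polar_def charactersD)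
    fix i assume "i < j"
    then have "((\<lambda>x. x + x) ^^ i) x \<in> W" using x by (auto simp: V_def)
    then show "Re (\<phi> x ^ 2 ^ i) \<ge> 0"
      using \<phi> character_funpow_double[of \<phi> i x] by (auto simp: polar_def)
  qed
  obtain Y where Y: "finite Y" "K n \<subseteq> (\<Union>y\<in>Y. (\<lambda>x. x - y) -` V)"
  proof (rule compactE_image[OF compact_K[of n], of UNIV "\<lambda>y. (\<lambda>x. x - y) -` V"])
    have "x \<in> (\<lambda>y. y - x) -` V" for x using V0 by simp
    then show "K n \<subseteq> (\<Union>y. (\<lambda>x. x - y) -` V)" by blast
  qed (use V in \<open>auto intro: open_vimage_minus\<close>)
  obtain \<Psi> where \<Psi>: "finite \<Psi>" "\<Psi> \<subseteq> polar W" "\<forall>f\<in>polar W. \<exists>g\<in>\<Psi>. \<forall>y\<in>Y. norm (f y - g y) \<le> e / 3"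
    by (rule finite_net[OF Y(1), of "e / 3" "polar W"]) (use e in \<open>auto simp: polar_def charactersD\<close>)
  have "near (K n) e f g" if f: "f \<in> polar W" and g: "g \<in> \<Psi>" and fg: "\<forall>y\<in>Y. norm (f y - g y) \<le> e / 3" for f g
    unfolding near_def
  proof
    fix x assume "x \<in> K n"
    then obtain y where y: "y \<in> Y" "x - y \<in> V" using Y(2) by auto
    have "norm (h x - h y) \<le> e / 3" if "h \<in> polar W" for h
      using small[OF that y(2)] that by (auto simp: polar_def norm_character_diff_minus_one)
    then have "norm (f x - f y) \<le> e / 3" "norm (g x - g y) \<le> e / 3" using f g \<Psi>(2) by auto
    moreover have "norm (f y - g y) \<le> e / 3" using fg y by blast
    moreover have "f x - g x = (f x - f y) + (f y - g y) - (g x - g y)" by simp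
    ultimately show "norm (f x - g x) \<le> e"
      using norm_triangle_ineq4[of "(f x - f y) + (f y - g y)" "g x - g y"]
        norm_triangle_ineq[of "f x - f y" "f y - g y"] by simp
  qed
  then show "\<exists>F. finite F \<and> F \<subseteq> characters \<and> (\<forall>\<phi>\<in>polar W. \<exists>f\<in>F. near (K n) e \<phi> f)"
    using \<Psi> by (intro exI[of _ \<Psi>]) (fastforce simp: polar_def)
qed

text \<open>Otherwise the set contains a sequence whose differences \<open>x i - x j\<close> with \<open>j < i\<close> lie outside
  \<^term>\<open>K i\<close>, so that they form a closed set without \<open>0\<close>.\<close>

lemma totally_bounded_subset_K:
  assumes T: "\<And>W. open W \<Longrightarrow> 0 \<in> W \<Longrightarrow>
    \<exists>\<C>. finite \<C> \<and> T \<subseteq> \<Union>\<C> \<and> (\<forall>C\<in>\<C>. \<forall>x\<in>C. \<forall>y\<in>C. x - y \<in> W)"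
  shows "\<exists>m. T \<subseteq> K m"
proof (rule ccontr)
  assume no: "\<not> (\<exists>m. T \<subseteq> K m)"
  have "\<exists>x. \<forall>i. x i \<in> T \<and> (\<forall>j<i. x i - x j \<notin> K i)"
  proof (rule dependent_wellorder_choice)
    fix i :: nat and f :: "nat \<Rightarrow> 'a"
    have "compact (\<Union>j<i. (\<lambda>k. f j + k) ` K i)"
      by (intro compact_UN compact_translation compact_K) auto
    \<comment> \<open>Finitely many translates of \<open>K i\<close> form a compact set, so a point
      of \<open>T\<close> outside some \<open>K m\<close> avoids them all.\<close>
    then obtain m where m: "(\<Union>j<i. (\<lambda>k. f j + k) ` K i) \<subseteq> K m" using compact_subset_K by blast
    obtain r where r: "r \<in> T" "r \<notin> K m" using no by blast
    have "r - f j \<notin> K i" if "j < i" for j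
    proof
      assume "r - f j \<in> K i"
      then have "f j + (r - f j) \<in> K m" using m that by blast
      then show False using r(2) by simp
    qed
    then show "\<exists>r. r \<in> T \<and> (\<forall>j<i. r - f j \<notin> K i)" using r(1) by blast
  qed auto
  then obtain x where x: "\<And>i. x i \<in> T" "\<And>i j. j < i \<Longrightarrow> x i - x j \<notin> K i" by blast
  define D where "D = {x i - x j |i j. j < i}"
  have "open (- D)"
  proof (rule openI_K)
    fix n
    \<comment> \<open>A difference with larger index \<open>i\<close> at least \<open>n\<close> lies
      outside \<open>K i\<close>, hence outside \<open>K n\<close>, so only finitely many
      differences meet \<open>K n\<close>.\<close>
    have "D \<inter> K n \<subseteq> (\<lambda>(i, j). x i - x j) ` ({..<n} \<times> {..<n})"
    proof
      fix d assume "d \<in> D \<inter> K n"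
      then obtain i j where ij: "d = x i - x j" "j < i" "d \<in> K n" by (auto simp: D_def)
      have "i < n"
      proof (rule ccontr)
        assume "\<not> i < n"
        then show False using ij x(2)[OF ij(2)] mono_K[of n i] by auto
      qed
      then show "d \<in> (\<lambda>(i, j). x i - x j) ` ({..<n} \<times> {..<n})" using ij by force
    qed
    then have "finite (D \<inter> K n)" by (rule finite_subset) simp
    then have "open (- (D \<inter> K n))" by (rule open_Compl[OF finite_imp_closed])
    moreover have "- D \<inter> K n = - (D \<inter> K n) \<inter> K n" by auto
    ultimately show "\<exists>V. open V \<and> - D \<inter> K n = V \<inter> K n" by blast
  qed
  moreover have "0 \<in> - D"
    using x(2) zero_in_K by (force simp: D_def)
  ultimately obtain \<C> where \<C>: "finite \<C>" "T \<subseteq> \<Union>\<C>" "\<forall>C\<in>\<C>. \<forall>x\<in>C. \<forall>y\<in>C. x - y \<in> - D"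
    using T[of "- D"] by blast
  have "\<exists>C. C \<in> \<C> \<and> x i \<in> C" for i using \<C>(2) x(1)[of i] by blast
  then obtain c where c: "\<And>i. c i \<in> \<C> \<and> x i \<in> c i" by metis
  have "finite (range c)" using c \<C>(1) by (intro finite_subset[of "range c" \<C>]) auto
  then have "\<not> inj c" using finite_imageD[of c UNIV] infinite_UNIV_nat by blast
  then obtain i j where "c i = c j" "i \<noteq> j" by (auto simp: inj_def)
  then obtain i j where ij: "c i = c j" "j < i" using linorder_neqE_nat[of i j] by metis
  have "x i \<in> c i" "x j \<in> c i" "c i \<in> \<C>" using c[of i] c[of j] ij(1) by auto
  then have "x i - x j \<in> - D" using \<C>(3) by blast
  then show False using ij(2) by (auto simp: D_def)
qed

section \<open>Compact polars in the group, and the failure of local compactness\<close>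

definition prepolar_ball :: "nat \<Rightarrow> 'a set" where
  "prepolar_ball n = {x. \<forall>\<phi>\<in>unit_ball n. Re (\<phi> x) \<ge> 0}"

text \<open>The set is closed, so it suffices to show it totally bounded in the group. For a
  quasiconvex \<open>V\<close>, the polar of \<open>V\<close> is approximated on \<open>K n\<close>
  by finitely many characters \<open>F\<close>; this approximation carries over to \<open>Q\<close>,
  and points of \<open>Q\<close> with almost the same values on \<open>F\<close> differ by an
  element of \<open>V\<close>.\<close>

lemma compact_prepolar_ball: "compact (prepolar_ball n)"
proof -
  define Q where "Q = prepolar_ball n"
  define \<delta> where "\<delta> = 1 / (real n + 1)"
  have \<delta>: "\<delta> > 0" by (simp add: \<delta>_def)
  have "\<exists>\<C>. finite \<C> \<and> Q \<subseteq> \<Union>\<C> \<and> (\<forall>C\<in>\<C>. \<forall>x\<in>C. \<forall>y\<in>C. x - y \<in> W)"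
    if W: "open W" "0 \<in> W" for W
  proof -
    obtain V N where V: "open N" "0 \<in> N" "N \<subseteq> V" "V \<subseteq> W" "quasiconvex V" using lqc[OF W] by blast
    have "tb (polar V)"
      by (rule tb_subset[OF tb_polar[OF V(1,2)]]) (use V(3) in \<open>auto simp: polar_def\<close>)
    \<comment> \<open>The factor 64 is \<open>2 ^ 6\<close>: all powers of \<open>\<phi> / f\<close>
      with exponent \<open>2 ^ i\<close>, \<open>i < 6\<close>, remain in the unit ball, so six
      doublings on \<open>Q\<close> give the distance \<open>2 / sqrt 2 ^ 6 = 1 / 4\<close>.\<close>
    then obtain F where F: "finite F" "F \<subseteq> characters" "\<forall>\<phi>\<in>polar V. \<exists>f\<in>F. near (K n) (\<delta> / 64) \<phi> f"
      using tbD[of "polar V" "\<delta> / 64" n] \<delta> by auto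
    have close: "norm (\<phi> x - f x) \<le> 1 / 4"
      if \<phi>: "\<phi> \<in> characters" and f: "f \<in> F" and near: "near (K n) (\<delta> / 64) \<phi> f" and x: "x \<in> Q" for \<phi> f x
    proof -
      have fX: "f \<in> characters" using f F(2) by blast
      have qX: "(\<lambda>x. \<phi> x / f x) \<in> characters" by (rule divide_in_characters[OF \<phi> fX])
      have "norm (\<phi> x / f x - 1) \<le> 2 / sqrt 2 ^ 6"
      proof (rule norm_minus_one_le_doubling)
        show "norm (\<phi> x / f x) = 1" using charactersD(2)[OF qX] .
        fix i :: nat assume i: "i < 6"
        have "(\<lambda>y. (\<phi> y / f y) ^ (2 ^ i)) \<in> unit_ball n"
          unfolding unit_ball_def near_def
        proof (intro CollectI conjI ballI)
          show "(\<lambda>y. (\<phi> y / f y) ^ (2 ^ i)) \<in> characters" by (rule power_in_characters[OF qX])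
          fix y assume y: "y \<in> K n"
          have "norm ((\<phi> y / f y) ^ (2 ^ i) - 1 ^ (2 ^ i)) \<le> real (2 ^ i) * norm (\<phi> y / f y - 1)"
            by (rule norm_power_diff) (use charactersD(2)[OF qX] in auto)
          also have "\<dots> \<le> 2 ^ 6 * (\<delta> / 64)"
            using near y charactersD(2)[OF fX] i
            by (intro mult_mono) (auto simp: near_def norm_divide_minus_one intro: order_trans[OF power_increasing[of i 6 "2::real"]])
          finally show "norm ((\<phi> y / f y) ^ (2 ^ i) - 1) \<le> 1 / (real n + 1)" by (simp add: \<delta>_def[symmetric])
        qed
        then show "Re ((\<phi> x / f x) ^ 2 ^ i) \<ge> 0" using x by (auto simp: Q_def prepolar_ball_def)
      qed
      moreover have "sqrt 2 ^ 6 = (8::real)"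
        using power_mult[of "sqrt 2" 2 3] by simp
      ultimately show ?thesis using charactersD(2)[OF fX] by (simp add: norm_divide_minus_one)
    qed
    \<comment> \<open>The roles are exchanged here: points of \<open>Q\<close> act as evaluation
      functionals on the finite index set \<open>F\<close>.\<close>
    obtain \<Psi> where \<Psi>: "finite \<Psi>" "\<forall>h\<in>(\<lambda>x \<phi>. \<phi> x) ` Q. \<exists>g\<in>\<Psi>. \<forall>f\<in>F. norm (h f - g f) \<le> 1 / 8"
      by (rule finite_net[OF F(1), of "1 / 8" "(\<lambda>x \<phi>. \<phi> x) ` Q"])
        (use F(2) in \<open>auto simp: charactersD subset_iff\<close>)
    define cell where "cell g = {x\<in>Q. \<forall>f\<in>F. norm (f x - g f) \<le> 1 / 8}" for g :: "('a \<Rightarrow> complex) \<Rightarrow> complex"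
    have "x - y \<in> W" if xy: "x \<in> cell g" "y \<in> cell g" for g x y
    proof -
      have "Re (\<phi> (x - y)) \<ge> 0" if \<phi>: "\<phi> \<in> polar V" for \<phi>
      proof -
        obtain f where f: "f \<in> F" "near (K n) (\<delta> / 64) \<phi> f" using F(3) \<phi> by blast
        have \<phi>X: "\<phi> \<in> characters" using \<phi> by (simp add: polar_def)
        have "norm (\<phi> x - f x) \<le> 1 / 4" "norm (\<phi> y - f y) \<le> 1 / 4"
          using close[OF \<phi>X f] xy by (auto simp: cell_def)
        moreover have "norm (f x - g f) \<le> 1 / 8" "norm (f y - g f) \<le> 1 / 8"
          using xy f(1) by (auto simp: cell_def)
        moreover have "\<phi> x - \<phi> y = ((\<phi> x - f x) + (f x - g f)) - ((\<phi> y - f y) + (f y - g f))" by simp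
        \<comment> \<open>Twice \<open>1 / 4 + 1 / 8\<close> is below 1, which keeps the real part
          of \<open>\<phi> (x - y)\<close> nonnegative.\<close>
        ultimately have "norm (\<phi> x - \<phi> y) \<le> 3 / 4"
          using norm_triangle_ineq4[of "(\<phi> x - f x) + (f x - g f)" "(\<phi> y - f y) + (f y - g f)"]
            norm_triangle_ineq[of "\<phi> x - f x" "f x - g f"] norm_triangle_ineq[of "\<phi> y - f y" "f y - g f"]
          by simp
        then show ?thesis
          using Re_ge_norm_minus_one[of "\<phi> (x - y)"] norm_character_diff_minus_one[OF \<phi>X, of x y] by simp
      qed
      then have "x - y \<in> V" using quasiconvex_separated[OF V(5), of "x - y"] by (meson not_le)
      then show ?thesis using V(4) by blast
    qed
    moreover have "Q \<subseteq> \<Union>(cell ` \<Psi>)" using \<Psi>(2) by (fastforce simp: cell_def)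
    ultimately show ?thesis using \<Psi>(1) by (intro exI[of _ "cell ` \<Psi>"]) auto
  qed
  then obtain m where "Q \<subseteq> K m" using totally_bounded_subset_K[of Q] by blast
  moreover have "closed Q"
  proof -
    have "Q = (\<Inter>\<phi>\<in>unit_ball n. {x. 0 \<le> Re (\<phi> x)})" by (auto simp: Q_def prepolar_ball_def)
    moreover have "closed {x. 0 \<le> Re (\<phi> x)}" if "\<phi> \<in> unit_ball n" for \<phi>
      using that by (intro closed_Collect_le continuous_intros) (auto simp: unit_ball_def charactersD)
    ultimately show ?thesis by auto
  qed
  ultimately have "compact Q" using compact_Int_closed[OF compact_K, of Q m] by (simp add: Int_absorb1)
  then show ?thesis by (simp add: Q_def)
qed

text \<open>A totally bounded ball would lie in the polar of a neighbourhood \<open>W\<close> of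
  \<open>0\<close>; then \<open>W\<close> lies in the compact prepolar, and translates of it give
  compact neighbourhoods everywhere.\<close>

lemma not_tb_unit_ball:
  assumes "\<not> locally_compact_space (euclidean :: 'a topology)"
  shows "\<not> tb (unit_ball n)"
proof
  assume "tb (unit_ball n)"
  then obtain W where W: "open W" "0 \<in> W" "unit_ball n \<subseteq> polar W" by (rule tb_imp_polar_nbhd)
  then have WQ: "W \<subseteq> prepolar_ball n" by (auto simp: polar_def prepolar_ball_def)
  have "locally_compact_space (euclidean :: 'a topology)"
    unfolding locally_compact_space_def
  proof
    fix x :: 'a
    have "open ((\<lambda>y. y - x) -` W)" by (rule open_vimage_minus[OF W(1)])
    moreover have "compact ((\<lambda>y. x + y) ` prepolar_ball n)"
      by (rule compact_translation[OF compact_prepolar_ball])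
    moreover have "(\<lambda>y. y - x) -` W \<subseteq> (\<lambda>y. x + y) ` prepolar_ball n"
      using WQ by (force simp: image_iff)
    ultimately show "\<exists>U C. openin euclidean U \<and> compactin euclidean C \<and> x \<in> U \<and> U \<subseteq> C"
      using W(2) by (intro exI[of _ "(\<lambda>y. y - x) -` W"] exI[of _ "(\<lambda>y. x + y) ` prepolar_ball n"]) auto
  qed
  then show False using assms by contradiction
qed

end

section \<open>Cosets\<close>

lemma add_subgroup_diff: "add_subgroup H \<Longrightarrow> x \<in> H \<Longrightarrow> y \<in> H \<Longrightarrow> x - y \<in> H"
  unfolding add_subgroup_def by (metis add_uminus_conv_diff)

lemma coset_eq_iff:
  assumes "add_subgroup H"
  shows "x +o H = y +o H \<longleftrightarrow> x - y \<in> H"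
proof
  assume "x +o H = y +o H"
  moreover have "x \<in> x +o H"
    using assms set_plus_intro2[of 0 H x] by (simp add: add_subgroup_def)
  ultimately obtain h where "h \<in> H" "x = y + h" by (auto simp: elt_set_plus_def)
  then show "x - y \<in> H" by simp
next
  assume xy: "x - y \<in> H"
  have "u +o H \<subseteq> v +o H" if uv: "u - v \<in> H" for u v
  proof
    fix z assume "z \<in> u +o H"
    then obtain h where h: "h \<in> H" "z = u + h" by (auto simp: elt_set_plus_def)
    then have "z = v + ((u - v) + h)" "(u - v) + h \<in> H"
      using uv assms by (auto simp: add_subgroup_def)
    then show "z \<in> v +o H" by (metis set_plus_intro2)
  qed
  moreover have "y - x \<in> H" using add_subgroup_diff[OF assms, of 0 "x - y"] xy assms
    by (simp add: add_subgroup_def)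
  ultimately show "x +o H = y +o H" using xy by blast
qed

definition lift_coset :: "'a :: topological_ab_group_add set \<Rightarrow> ('a \<Rightarrow> complex) \<Rightarrow> 'a set \<Rightarrow> complex" where
  "lift_coset H \<phi> c = \<phi> (SOME x. x +o H = c)"

text \<open>A character trivial on \<open>H\<close> is constant on cosets, so the chosen
  representative is immaterial; continuity is the universal property of the quotient map.\<close>

lemma lift_coset:
  assumes "add_subgroup H" "\<phi> \<in> characters" "\<And>x. x \<in> H \<Longrightarrow> \<phi> x = 1"
  shows "lift_coset H \<phi> (x +o H) = \<phi> x"
    and "continuous_map (quotient_space H) euclidean (lift_coset H \<phi>)"
proof -
  show *: "lift_coset H \<phi> (x +o H) = \<phi> x" for x
  proof -
    define y where "y = (SOME y. y +o H = x +o H)"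
    have "y +o H = x +o H" unfolding y_def by (rule someI) (rule refl)
    then have "\<phi> (y - x) = 1" using coset_eq_iff[OF assms(1)] assms(3) by blast
    then have "\<phi> y = \<phi> x" using character_diff[OF assms(2)] character_nonzero[OF assms(2)] by simp
    then show ?thesis by (simp add: lift_coset_def y_def)
  qed
  have "lift_coset H \<phi> \<circ> (\<lambda>x. x +o H) = \<phi>" using * by auto
  then have "continuous_map euclidean euclidean (lift_coset H \<phi> \<circ> (\<lambda>x. x +o H))"
    using charactersD(1)[OF assms(2)] by simp
  then show "continuous_map (quotient_space H) euclidean (lift_coset H \<phi>)"
    by (rule continuous_compose_quotient_map[OF quotient_map_quotient_space])
qed

section \<open>Lower bounds for the character\<close>

lemma infinite_dominating:
  fixes C :: "(nat \<Rightarrow> nat) set"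
  assumes "cofinal_in UNIV (\<le>) C"
  shows "infinite C"
proof
  assume C: "finite C"
  \<comment> \<open>One more than the sum of a finite family exceeds each of its members.\<close>
  obtain c where c: "c \<in> C" "(\<lambda>n. (\<Sum>g\<in>C. g n) + 1) \<le> c"
    using assms by (auto simp: cofinal_in_def)
  have "c 0 \<le> (\<Sum>g\<in>C. g 0)" using C c(1) by (intro member_le_sum) auto
  then show False using le_funD[OF c(2), of 0] by simp
qed

lemma cof_attained:
  assumes "\<And>p. p \<in> P \<Longrightarrow> le p p"
  obtains C where "cofinal_in P le C" "cof P le = |C|"
proof (rule min_Card_attained[of "cofinal_in P le" P])
  show "cofinal_in P le P" using assms by (auto simp: cofinal_in_def)
  fix C assume "cofinal_in P le C" "min_Card { |B| |B. cofinal_in P le B} = |C|"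
  then show thesis using that by (simp add: cof_def)
qed

lemma cof_le: "cofinal_in P le C \<Longrightarrow> cof P le \<le>o |C|"
  unfolding cof_def by (rule min_Card_le)

lemma dominating_family:
  obtains C where "cofinal_in UNIV (\<le>) C" "dominating_number = |C|" "infinite C"
  using cof_attained[of UNIV "(\<le>) :: (nat \<Rightarrow> nat) \<Rightarrow> _"] infinite_dominating
  unfolding dominating_number_def by auto

lemma nbhd_diff:
  fixes W :: "'a :: topological_ab_group_add set"
  assumes "open W" "0 \<in> W"
  obtains V where "open V" "0 \<in> V" "\<And>x y. x \<in> V \<Longrightarrow> y \<in> V \<Longrightarrow> x - y \<in> W"
proof -
  have "continuous_on UNIV (\<lambda>p :: 'a \<times> 'a. fst p + - snd p)"
    by (intro continuous_on_add continuous_on_minus continuous_on_fst continuous_on_snd continuous_on_id)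
  then have "open ((\<lambda>p :: 'a \<times> 'a. fst p + - snd p) -` W)" by (intro open_vimage assms)
  moreover have "(0, 0) \<in> (\<lambda>p :: 'a \<times> 'a. fst p + - snd p) -` W" using assms by simp
  ultimately obtain A B where AB: "open A" "open B" "(0, 0) \<in> A \<times> B"
      "A \<times> B \<subseteq> (\<lambda>p :: 'a \<times> 'a. fst p + - snd p) -` W"
    by (rule open_prod_elim)
  show thesis
  proof (rule that[of "A \<inter> B"])
    fix x y assume "x \<in> A \<inter> B" "y \<in> A \<inter> B"
    then have "(x, y) \<in> (\<lambda>p :: 'a \<times> 'a. fst p + - snd p) -` W" using AB by blast
    then show "x - y \<in> W" by simp
  qed (use AB in auto)
qed

text \<open>For each \<open>V\<close> in \<open>B\<close> finitely many translates cover the compact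
  set \<open>L\<close>, and the traces of all these translates form a base of
  \<open>L\<close>.\<close>

lemma compact_weight_le_local_base:
  fixes B :: "'a :: topological_ab_group_add set set"
  assumes B: "local_base_at (0::'a) euclidean B" and inf: "infinite B"
  shows "compact_weight (euclidean :: 'a topology) \<le>o |B|"
proof (rule compact_weight_least)
  fix L :: "'a set" assume "compactin euclidean L"
  then have L: "compact L" by simp
  have r: "Cinfinite |B|" using inf by (rule Cinfinite_card_of)
  have Bo: "open V" "0 \<in> V" if "V \<in> B" for V using B that by (auto simp: local_base_at_def)
  have "\<exists>F. finite F \<and> L \<subseteq> (\<Union>f\<in>F. (\<lambda>x. x - f) -` V)" if V: "V \<in> B" for V
  proof (rule compactE_image[OF L, of UNIV "\<lambda>f. (\<lambda>x. x - f) -` V"])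
    have "x \<in> (\<lambda>y. y - x) -` V" for x using Bo[OF V] by simp
    then show "L \<subseteq> (\<Union>f. (\<lambda>x. x - f) -` V)" by blast
  qed (use Bo[OF V] in \<open>auto intro: open_vimage_minus\<close>)
  then obtain F where F: "\<And>V. V \<in> B \<Longrightarrow> finite (F V) \<and> L \<subseteq> (\<Union>f\<in>F V. (\<lambda>x. x - f) -` V)" by metis
  define \<G> where "\<G> = (\<Union>V\<in>B. (\<lambda>f. (\<lambda>x. x - f) -` V \<inter> L) ` F V)"
  have "base_of (subtopology euclidean L) \<G>"
    unfolding base_of_def
  proof (intro conjI allI impI ballI)
    fix G assume "G \<in> \<G>"
    then obtain V f where "V \<in> B" "G = (\<lambda>x. x - f) -` V \<inter> L" by (auto simp: \<G>_def)
    moreover have "open ((\<lambda>x. x - f) -` V)" using Bo(1)[OF \<open>V \<in> B\<close>] by (rule open_vimage_minus)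
    ultimately show "openin (subtopology euclidean L) G" by (auto simp: openin_subtopology)
  next
    fix U x assume "openin (subtopology euclidean L) U \<and> x \<in> U"
    then obtain T where T: "open T" "U = T \<inter> L" and x: "x \<in> T" "x \<in> L"
      by (auto simp: openin_subtopology)
    have "open ((\<lambda>z. z - (- x)) -` T)" by (rule open_vimage_minus[OF T(1)])
    moreover have "0 \<in> (\<lambda>z. z - (- x)) -` T" using x by simp
    ultimately obtain N where N: "open N" "0 \<in> N" "\<And>y z. y \<in> N \<Longrightarrow> z \<in> N \<Longrightarrow> y - z \<in> (\<lambda>z. z - (- x)) -` T"
      using nbhd_diff by blast
    obtain V where V: "V \<in> B" "V \<subseteq> N" using B N by (auto simp: local_base_at_def)
    obtain f where f: "f \<in> F V" "x - f \<in> V" using F[OF V(1)] x(2) by auto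
    have "(\<lambda>x. x - f) -` V \<inter> L \<subseteq> U"
    proof
      fix y assume y: "y \<in> (\<lambda>x. x - f) -` V \<inter> L"
      \<comment> \<open>Both \<open>x\<close> and \<open>y\<close> lie in the same translate of
        \<open>V\<close>, so \<open>y - x\<close> is a difference of two elements of
        \<open>N\<close>.\<close>
      then have "(y - f) - (x - f) \<in> (\<lambda>z. z - (- x)) -` T" using N(3) V(2) f(2) by blast
      then show "y \<in> U" using y T(2) by simp
    qed
    then show "\<exists>V\<in>\<G>. x \<in> V \<and> V \<subseteq> U"
      using f x V(1) by (intro bexI[of _ "(\<lambda>x. x - f) -` V \<inter> L"]) (auto simp: \<G>_def)
  qed
  then have "weight (subtopology euclidean L) \<le>o |\<G>|" by (rule weight_le)
  also have "|\<G>| \<le>o |B|"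
    unfolding \<G>_def
  proof (rule UNION_Cinfinite_bound[OF _ _ r])
    show "\<forall>V\<in>B. |(\<lambda>f. (\<lambda>x. x - f) -` V \<inter> L) ` F V| \<le>o |B|"
      using F r by (intro ballI countable_ordLeq_Cinfinite) (auto intro: countable_finite)
  qed (rule ordLeq_refl[OF card_of_Card_order])
  finally show "weight (subtopology euclidean L) \<le>o |B|" .
qed (rule card_of_Card_order)

section \<open>Lower bounds through polars of a local base\<close>

context k_omega_group
begin

text \<open>The polars of a local base are cofinal among the totally bounded sets; with
  \<open>tb_polar_local_base\<close> this turns bounds on totally bounded sets into bounds on
  \<open>B\<close>.\<close>

lemma local_base_polar:
  assumes B: "local_base_at (0::'a) euclidean B" and P: "tb P"
  shows "\<exists>W\<in>B. P \<subseteq> polar W"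
proof -
  obtain N where N: "open N" "0 \<in> N" "P \<subseteq> polar N" using tb_imp_polar_nbhd[OF P] .
  then obtain W where "W \<in> B" "W \<subseteq> N" using B by (auto simp: local_base_at_def)
  then show ?thesis using N(3) by (intro bexI[of _ W]) (auto simp: polar_def)
qed

lemma tb_polar_local_base:
  assumes "local_base_at (0::'a) euclidean B" "W \<in> B"
  shows "tb (polar W)"
  using assms by (intro tb_polar) (auto simp: local_base_at_def)

text \<open>Total boundedness of the ball fails for some \<open>K m\<close> and \<open>e\<close>. A
  maximal \<open>e\<close>-separated subset is an \<open>e\<close>-net and hence infinite, while
  totally bounded sets meet it in finite sets.\<close>

lemma exists_infinite_separated:
  assumes "\<not> locally_compact_space (euclidean :: 'a topology)"
  shows "\<exists>x. inj x \<and> range x \<subseteq> unit_ball n \<and> (\<forall>P. tb P \<longrightarrow> finite {i :: nat. x i \<in> P})"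
proof -
  have U: "unit_ball n \<subseteq> characters" by (auto simp: unit_ball_def)
  with not_tb_unit_ball[OF assms, of n] obtain m e where e: "e > 0"
    and no: "\<not> (\<exists>F. finite F \<and> F \<subseteq> characters \<and> (\<forall>\<phi>\<in>unit_ball n. \<exists>f\<in>F. near (K m) e \<phi> f))"
    unfolding tb_def by blast
  obtain S where S: "S \<subseteq> unit_ball n" "\<forall>f\<in>S. \<forall>g\<in>S. near (K m) e f g \<longrightarrow> f = g"
      "\<forall>f\<in>unit_ball n. \<exists>g\<in>S. near (K m) e f g"
    by (rule exists_maximal_separated[of e "unit_ball n" "K m"]) (use e in auto)
  have "infinite S"
  proof
    assume "finite S"
    moreover have "S \<subseteq> characters" using S(1) U by blast
    ultimately show False using no S(3) by blast
  qed
  then obtain x :: "nat \<Rightarrow> 'a \<Rightarrow> complex" where x: "inj x" "range x \<subseteq> S"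
    using infinite_countable_subset by blast
  have "finite {i. x i \<in> P}" if "tb P" for P
  proof -
    have "{i. x i \<in> P} = x -` (P \<inter> S)" using x(2) by auto
    moreover have "finite (x -` (P \<inter> S))"
      by (rule finite_vimageI[OF tb_Int_separated_finite[OF that e S(2)] x(1)])
    ultimately show ?thesis by metis
  qed
  then show ?thesis using x S(1) by blast
qed

text \<open>With a separated sequence \<open>x n\<close> in each ball, a function \<open>f\<close>
  selects the first \<open>f n + 1\<close> terms of each. This choice is totally bounded, so some
  polar contains it, and the largest index that this polar catches in each sequence dominates
  \<open>f\<close>.\<close>

lemma dominating_number_le:
  assumes nlc: "\<not> locally_compact_space (euclidean :: 'a topology)" and B: "local_base_at (0::'a) euclidean B"
  shows "dominating_number \<le>o |B|"
proof -
  obtain x :: "nat \<Rightarrow> nat \<Rightarrow> 'a \<Rightarrow> complex" where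
      x: "\<And>n. inj (x n) \<and> range (x n) \<subseteq> unit_ball n \<and> (\<forall>P. tb P \<longrightarrow> finite {i. x n i \<in> P})"
    using exists_infinite_separated[OF nlc] by metis
  \<comment> \<open>Inserting \<open>0\<close> gives \<open>Max\<close> a value when the polar
    misses the sequence.\<close>
  define g where "g W n = Max (insert 0 {i. x n i \<in> polar W})" for W n
  have "\<exists>c\<in>g ` B. f \<le> c" for f
  proof -
    have "tb (\<Union>n. x n ` {..f n})" by (rule tb_Union_null_sequence) (use x in auto)
    then obtain W where W: "W \<in> B" "(\<Union>n. x n ` {..f n}) \<subseteq> polar W"
      using local_base_polar[OF B] by blast
    have "f n \<le> g W n" for n
      unfolding g_def
    proof (rule Max_ge)
      show "finite (insert 0 {i. x n i \<in> polar W})" using x tb_polar_local_base[OF B W(1)] by blast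
      have "x n (f n) \<in> polar W" using W(2) by blast
      then show "f n \<in> insert 0 {i. x n i \<in> polar W}" by simp
    qed
    then show ?thesis using W(1) by (auto simp: le_fun_def)
  qed
  then have "dominating_number \<le>o |g ` B|"
    unfolding dominating_number_def by (intro cof_le) (auto simp: cofinal_in_def)
  then show ?thesis using card_of_image ordLeq_transitive by blast
qed

text \<open>The common kernel of the ball: a compact subgroup at which the minimality of the
  quotient weight is exploited.\<close>

definition annihilator :: "nat \<Rightarrow> 'a set" where
  "annihilator n = {x. \<forall>\<phi>\<in>unit_ball n. \<phi> x = 1}"

lemma compact_annihilator: "compact (annihilator n)"
proof -
  have "annihilator n = (\<Inter>\<phi>\<in>unit_ball n. {x. \<phi> x = 1})" by (auto simp: annihilator_def)
  moreover have "closed {x. \<phi> x = 1}" if "\<phi> \<in> unit_ball n" for \<phi>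
    using that by (intro closed_Collect_eq continuous_intros) (auto simp: unit_ball_def charactersD)
  ultimately have "closed (annihilator n)" by auto
  then have "compact (prepolar_ball n \<inter> annihilator n)"
    by (rule compact_Int_closed[OF compact_prepolar_ball])
  moreover have "annihilator n \<subseteq> prepolar_ball n"
    by (auto simp: annihilator_def prepolar_ball_def)
  ultimately show ?thesis by (simp add: Int_absorb1)
qed

lemma add_subgroup_annihilator: "add_subgroup (annihilator n)"
proof -
  have "\<phi> (- x) = 1" if "\<phi> \<in> unit_ball n" "\<phi> x = 1" for \<phi> x
    using character_diff[of \<phi> 0 x] that by (simp add: unit_ball_def character_zero)
  then show ?thesis
    by (auto simp: add_subgroup_def annihilator_def unit_ball_def character_zero charactersD(3))
qed

text \<open>Two cosets are separated by a character of the ball, hence by a member of a sufficiently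
  fine net. So the lifted nets separate the points of each compact subset of the quotient, and
  \<open>weight_le_separating\<close> applies.\<close>

lemma compact_weight_quotient_annihilator_le:
  assumes S: "\<And>m. S m \<subseteq> unit_ball n"
      "\<And>m. \<forall>f\<in>unit_ball n. \<exists>g\<in>S m. near (K m) (1 / (real m + 1)) f g"
    and r: "Cinfinite r" and le: "|\<Union>m. S m| \<le>o r"
  shows "compact_weight (quotient_space (annihilator n)) \<le>o r"
proof (rule compact_weight_least)
  define H where "H = annihilator n"
  note H = add_subgroup_annihilator[of n, folded H_def]
  fix L assume "compactin (quotient_space (annihilator n)) L"
  then have L: "compactin (quotient_space H) L" by (simp add: H_def)
  have ball: "\<phi> \<in> characters" "\<And>x. x \<in> H \<Longrightarrow> \<phi> x = 1" if "\<phi> \<in> unit_ball n" for \<phi>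
    using that by (auto simp: unit_ball_def H_def annihilator_def)
  have lift: "lift_coset H \<phi> (x +o H) = \<phi> x"
      "continuous_map (quotient_space H) euclidean (lift_coset H \<phi>)" if "\<phi> \<in> unit_ball n" for \<phi> x
    using lift_coset[OF H ball[OF that]] by auto
  have "weight (subtopology (quotient_space H) L) \<le>o r"
  proof (rule weight_le_separating[OF _ card_of_image_ordLeq[OF le] r])
    show "compact_space (subtopology (quotient_space H) L)"
      using L by (simp add: compactin_subspace)
    fix f assume "f \<in> lift_coset H ` (\<Union>m. S m)"
    then show "continuous_map (subtopology (quotient_space H) L) euclidean f"
    proof
      fix g assume g: "f = lift_coset H g" "g \<in> (\<Union>m. S m)"
      then have "g \<in> unit_ball n" using S(1) by blast
      then show ?thesis unfolding g(1) by (intro continuous_map_from_subtopology lift(2))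
    qed
  next
    fix c d assume "c \<in> topspace (subtopology (quotient_space H) L)"
      "d \<in> topspace (subtopology (quotient_space H) L)" "c \<noteq> d"
    then obtain x y where xy: "c = x +o H" "d = y +o H" by (auto simp: topspace_quotient_space)
    with \<open>c \<noteq> d\<close> have "x - y \<notin> H" by (simp add: coset_eq_iff[OF H])
    then obtain \<phi> where \<phi>: "\<phi> \<in> unit_ball n" "\<phi> (x - y) \<noteq> 1" by (auto simp: H_def annihilator_def)
    then have "\<phi> x \<noteq> \<phi> y"
      using character_diff[OF ball(1)[OF \<phi>(1)]] character_nonzero[OF ball(1)[OF \<phi>(1)]] by auto
    then have "norm (\<phi> x - \<phi> y) / 2 > 0" by simp
    then obtain k where k: "1 / (real k + 1) < norm (\<phi> x - \<phi> y) / 2"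
      using reals_Archimedean by (metis Suc_eq_plus1 inverse_eq_divide of_nat_1 of_nat_add)
    obtain a where a: "x \<in> K a" using in_some_K by blast
    obtain b where b: "y \<in> K b" using in_some_K by blast
    \<comment> \<open>Large enough for both representatives to lie in \<open>K m\<close> and for the
      radius to be below half the gap of \<open>\<phi>\<close>.\<close>
    define m where "m = max k (max a b)"
    have "1 / (real m + 1) \<le> 1 / (real k + 1)" by (intro divide_left_mono) (auto simp: m_def)
    with k have m: "1 / (real m + 1) < norm (\<phi> x - \<phi> y) / 2" by linarith
    have "a \<le> m" "b \<le> m" by (auto simp: m_def)
    then have xyK: "x \<in> K m" "y \<in> K m" using a b mono_K by blast+
    obtain g where g: "g \<in> S m" "near (K m) (1 / (real m + 1)) \<phi> g" using S(2) \<phi>(1) by blast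
    have "g x \<noteq> g y"
    proof
      assume "g x = g y"
      then have "\<phi> x - \<phi> y = (\<phi> x - g x) - (\<phi> y - g y)" by simp
      then have "norm (\<phi> x - \<phi> y) \<le> norm (\<phi> x - g x) + norm (\<phi> y - g y)"
        by (metis norm_triangle_ineq4)
      moreover have "norm (\<phi> x - g x) \<le> 1 / (real m + 1)" "norm (\<phi> y - g y) \<le> 1 / (real m + 1)"
        using g(2) xyK by (auto simp: near_def)
      ultimately show False using m by linarith
    qed
    moreover have "g \<in> unit_ball n" using g(1) S(1) by blast
    ultimately have "lift_coset H g c \<noteq> lift_coset H g d" using lift(1) xy by simp
    then show "\<exists>f\<in>lift_coset H ` (\<Union>m. S m). f c \<noteq> f d" using g(1) by blast
  qed
  then show "weight (subtopology (quotient_space (annihilator n)) L) \<le>o r" by (simp add: H_def)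
qed (use r in simp)

text \<open>The \<open>n\<close>-th element of a countable set \<open>M\<close> is sent into the
  \<open>n\<close>-th ball by an injection \<open>x n\<close>, so the images form a totally bounded
  set, caught by one polar. Conversely \<open>A W\<close>, the indices caught by the polar of
  \<open>W\<close>, is countable, as a polar meets each separated set \<open>S n m\<close> in a
  finite set.\<close>

lemma cof_countable_subsets_le_inj:
  assumes B: "local_base_at (0::'a) euclidean B"
    and S: "\<And>n m. S n m \<subseteq> unit_ball n"
      "\<And>n m. \<forall>f\<in>S n m. \<forall>g\<in>S n m. near (K m) (1 / (real m + 1)) f g \<longrightarrow> f = g"
    and le: "\<And>n. |Field r| \<le>o |\<Union>m. S n m|"
  shows "cof (countably_infinite_subsets r) (\<subseteq>) \<le>o |B|"
proof -
  have "\<exists>x. inj_on x (Field r) \<and> x ` Field r \<subseteq> (\<Union>m. S n m)" for n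
    using le[of n] card_of_ordLeq[of "Field r" "\<Union>m. S n m"] by blast
  then obtain x where x: "\<And>n. inj_on (x n) (Field r) \<and> x n ` Field r \<subseteq> (\<Union>m. S n m)" by metis
  define A where "A W = {\<alpha>\<in>Field r. \<exists>n. x n \<alpha> \<in> polar W}" for W
  have count: "countable (A W)" if W: "W \<in> B" for W
  proof -
    have "countable {\<alpha>\<in>Field r. x n \<alpha> \<in> polar W}" for n
    proof (rule countable_image_inj_on)
      have "x n ` {\<alpha>\<in>Field r. x n \<alpha> \<in> polar W} \<subseteq> (\<Union>m. polar W \<inter> S n m)" using x[of n] by blast
      moreover have "countable (polar W \<inter> S n m)" for m
        using tb_Int_separated_finite[OF tb_polar_local_base[OF B W] _ S(2), of m n]
        by (intro countable_finite) simp
      ultimately show "countable (x n ` {\<alpha>\<in>Field r. x n \<alpha> \<in> polar W})"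
        by (meson countable_UN countable_subset countableI_type)
      show "inj_on (x n) {\<alpha>\<in>Field r. x n \<alpha> \<in> polar W}"
        using x[of n] by (auto intro: inj_on_subset)
    qed
    then have "countable (\<Union>n. {\<alpha>\<in>Field r. x n \<alpha> \<in> polar W})" by blast
    moreover have "A W = (\<Union>n. {\<alpha>\<in>Field r. x n \<alpha> \<in> polar W})" by (auto simp: A_def)
    ultimately show ?thesis by simp
  qed
  have "cofinal_in (countably_infinite_subsets r) (\<subseteq>) {C \<in> A ` B. infinite C}"
    unfolding cofinal_in_def
  proof (intro conjI ballI)
    show "{C \<in> A ` B. infinite C} \<subseteq> countably_infinite_subsets r"
      using count by (auto simp: countably_infinite_subsets_def A_def)
    fix M assume "M \<in> countably_infinite_subsets r"
    then have M: "M \<subseteq> Field r" "countable M" "infinite M" by (auto simp: countably_infinite_subsets_def)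
    then have rng: "range (from_nat_into M) = M" by (intro range_from_nat_into) auto
    have "tb (\<Union>n. {x n (from_nat_into M n)})"
    proof (rule tb_Union_null_sequence)
      fix n
      have "from_nat_into M n \<in> Field r" using M(1) rng by blast
      then have "x n (from_nat_into M n) \<in> (\<Union>m. S n m)" using x[of n] by blast
      then show "{x n (from_nat_into M n)} \<subseteq> unit_ball n" using S(1) by blast
    qed simp
    then obtain W where W: "W \<in> B" "(\<Union>n. {x n (from_nat_into M n)}) \<subseteq> polar W"
      using local_base_polar[OF B] by blast
    have "M \<subseteq> A W"
    proof
      fix \<alpha> assume \<alpha>: "\<alpha> \<in> M"
      then obtain n where "\<alpha> = from_nat_into M n" using rng by blast
      then have "x n \<alpha> \<in> polar W" using W(2) by blast
      then show "\<alpha> \<in> A W" using M(1) \<alpha> by (auto simp: A_def)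
    qed
    then show "\<exists>C\<in>{C \<in> A ` B. infinite C}. M \<subseteq> C"
      using W(1) M(3) infinite_super by (intro bexI[of _ "A W"]) auto
  qed
  then have "cof (countably_infinite_subsets r) (\<subseteq>) \<le>o |{C \<in> A ` B. infinite C}|" by (rule cof_le)
  also have "|{C \<in> A ` B. infinite C}| \<le>o |A ` B|" by (rule card_of_mono1) auto
  also have "|A ` B| \<le>o |B|" by (rule card_of_image)
  finally show ?thesis .
qed

text \<open>The injections exist because \<open>r\<close> is at most the compact weight of the
  quotient by \<open>annihilator n\<close>, which the maximal separated sets in the
  \<open>n\<close>-th ball bound.\<close>

lemma cof_countable_subsets_le:
  assumes B: "local_base_at (0::'a) euclidean B" and r: "Card_order r"
    and le: "\<And>H :: 'a set. add_subgroup H \<Longrightarrow> compact H \<Longrightarrow> r \<le>o compact_weight (quotient_space H)"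
  shows "cof (countably_infinite_subsets r) (\<subseteq>) \<le>o |B|"
proof (cases "countable (Field r)")
  case True
  \<comment> \<open>A countable \<open>Field r\<close> is the largest member of the family if it is
    infinite, and the family is empty if it is finite; the filter covers both cases.\<close>
  have "cofinal_in (countably_infinite_subsets r) (\<subseteq>) {M \<in> {Field r}. infinite M}"
    using True by (auto simp: cofinal_in_def countably_infinite_subsets_def dest: finite_subset)
  then have "cof (countably_infinite_subsets r) (\<subseteq>) \<le>o |{M \<in> {Field r}. infinite M}|" by (rule cof_le)
  also have "|{M \<in> {Field r}. infinite M}| \<le>o |{Field r}|" by (rule card_of_mono1) auto
  also have "|{Field r}| \<le>o |B|"
  proof -
    obtain W where "W \<in> B" using B unfolding local_base_at_def by (metis UNIV_I open_UNIV open_openin)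
    then show ?thesis by (auto intro!: card_of_singl_ordLeq)
  qed
  finally show ?thesis .
next
  case False
  have "\<exists>S. S \<subseteq> unit_ball n \<and> (\<forall>f\<in>S. \<forall>g\<in>S. near (K m) (1 / (real m + 1)) f g \<longrightarrow> f = g) \<and>
      (\<forall>f\<in>unit_ball n. \<exists>g\<in>S. near (K m) (1 / (real m + 1)) f g)" for n m
    by (rule exists_maximal_separated[of "1 / (real m + 1)" "unit_ball n" "K m"]) auto
  then obtain S where S: "\<And>n m. S n m \<subseteq> unit_ball n"
      "\<And>n m. \<forall>f\<in>S n m. \<forall>g\<in>S n m. near (K m) (1 / (real m + 1)) f g \<longrightarrow> f = g"
      "\<And>n m. \<forall>f\<in>unit_ball n. \<exists>g\<in>S n m. near (K m) (1 / (real m + 1)) f g"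
    by metis
  show ?thesis
  proof (rule cof_countable_subsets_le_inj[OF B S(1,2)])
    fix n
    have bound: "|Field r| \<le>o s" if s: "Cinfinite s" "|\<Union>m. S n m| \<le>o s" for s :: "'s rel"
    proof -
      have "|Field r| =o r" by (rule card_of_Field_ordIso[OF r])
      also have "r \<le>o compact_weight (quotient_space (annihilator n))"
        by (rule le[OF add_subgroup_annihilator compact_annihilator])
      also have "compact_weight (quotient_space (annihilator n)) \<le>o s"
        by (rule compact_weight_quotient_annihilator_le[OF S(1,3) s])
      finally show ?thesis .
    qed
    \<comment> \<open>The weight bound asks for an infinite cardinal. A finite union would allow
      \<open>natLeq\<close>, making \<open>Field r\<close> countable.\<close>
    have "infinite (\<Union>m. S n m)"
    proof
      assume "finite (\<Union>m. S n m)"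
      then have "|\<Union>m. S n m| \<le>o natLeq"
        by (intro countable_ordLeq_Cinfinite natLeq_Cinfinite countable_finite)
      then have "|Field r| \<le>o natLeq" by (rule bound[OF natLeq_Cinfinite])
      then have "|Field r| \<le>o |UNIV :: nat set|"
        by (rule ordLeq_ordIso_trans[OF _ ordIso_symmetric[OF card_of_nat]])
      then obtain f :: "_ \<Rightarrow> nat" where "inj_on f (Field r)"
        unfolding card_of_ordLeq[symmetric] by blast
      then show False using False by (auto simp: countable_def)
    qed
    then show "|Field r| \<le>o |\<Union>m. S n m|"
      by (rule bound[OF Cinfinite_card_of ordLeq_refl[OF card_of_Card_order]])
  qed
qed

end

section \<open>The upper bound for the character\<close>

lemma powers_in_subgroup:
  assumes H: "add_subgroup H" and x: "x \<in> H" and \<phi>: "\<phi> \<in> characters"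
  obtains y where "y \<in> H" "\<phi> y = \<phi> x ^ n"
proof -
  have "\<exists>y\<in>H. \<phi> y = \<phi> x ^ n"
  proof (induction n)
    case 0
    then show ?case using H character_zero[OF \<phi>] by (auto simp: add_subgroup_def)
  next
    case (Suc n)
    then obtain y where "y \<in> H" "\<phi> y = \<phi> x ^ n" by blast
    then show ?case using H x charactersD(3)[OF \<phi>, of x y]
      by (intro bexI[of _ "x + y"]) (auto simp: add_subgroup_def)
  qed
  then show thesis using that by blast
qed

text \<open>The values of \<open>\<phi>\<close> on \<open>H\<close> are closed under powers and lie
  in the right half plane, hence are all 1.\<close>

lemma character_trivial_on_subgroup:
  assumes H: "add_subgroup H" and \<phi>: "\<phi> \<in> characters" and near: "near H (1 / 2) \<phi> (\<lambda>x. 1)" and x: "x \<in> H"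
  shows "\<phi> x = 1"
proof (rule eq_one_if_powers_Re_nonneg)
  fix n
  obtain y where "y \<in> H" "\<phi> y = \<phi> x ^ n" using powers_in_subgroup[OF H x \<phi>] .
  then show "Re (\<phi> x ^ n) \<ge> 0"
    using near Re_ge_norm_minus_one[of "\<phi> y"] by (force simp: near_def)
qed (rule charactersD(2)[OF \<phi>])

text \<open>The family \<open>C\<close> is pulled back along an injection of \<open>D\<close> into
  \<open>Field r\<close>.\<close>

lemma cofinal_countable_family:
  assumes D: "|D| \<le>o |Field r|" and C: "cofinal_in (countably_infinite_subsets r) (\<subseteq>) C"
    and inf: "infinite (Field r)"
  obtains h where "\<forall>c\<in>C. countable (h c) \<and> h c \<subseteq> D" "\<forall>A. countable A \<and> A \<subseteq> D \<longrightarrow> (\<exists>c\<in>C. A \<subseteq> h c)"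
proof -
  obtain f where f: "inj_on f D" "f ` D \<subseteq> Field r"
    using D unfolding card_of_ordLeq[symmetric] by blast
  define h where "h c = {d\<in>D. f d \<in> c}" for c
  obtain M where M: "M \<subseteq> Field r" "countable M" "infinite M"
    using infinite_countable_subset'[OF inf] by blast
  show thesis
  proof (rule that[of h])
    show "\<forall>c\<in>C. countable (h c) \<and> h c \<subseteq> D"
    proof
      fix c assume "c \<in> C"
      then have "countable c" using C by (auto simp: cofinal_in_def countably_infinite_subsets_def)
      moreover have "f ` h c \<subseteq> c" by (auto simp: h_def)
      ultimately have "countable (f ` h c)" by (rule countable_subset[rotated])
      moreover have "inj_on f (h c)" using f(1) by (rule inj_on_subset) (auto simp: h_def)
      ultimately show "countable (h c) \<and> h c \<subseteq> D"
        by (auto intro: countable_image_inj_on simp: h_def)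
    qed
    show "\<forall>A. countable A \<and> A \<subseteq> D \<longrightarrow> (\<exists>c\<in>C. A \<subseteq> h c)"
    proof (intro allI impI)
      fix A assume A: "countable A \<and> A \<subseteq> D"
      \<comment> \<open>Joining \<open>M\<close> makes the set infinite even when \<open>A\<close>
        is finite.\<close>
      then have "f ` A \<union> M \<in> countably_infinite_subsets r"
        using f(2) M by (auto simp: countably_infinite_subsets_def)
      then obtain c where "c \<in> C" "f ` A \<union> M \<subseteq> c" using C unfolding cofinal_in_def by blast
      then show "\<exists>c\<in>C. A \<subseteq> h c" using A by (intro bexI[of _ c]) (auto simp: h_def)
    qed
  qed
qed

section \<open>Dense sets of characters and a cofinal family of totally bounded sets\<close>

context k_omega_group
begin

lemma dense_subset_from_nets:
  assumes r: "Cinfinite r"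
    and net: "\<And>n e. e > 0 \<Longrightarrow> \<exists>\<Psi>. \<Psi> \<subseteq> \<Phi> \<and> |\<Psi>| \<le>o r \<and> (\<forall>\<phi>\<in>\<Phi>. \<exists>\<psi>\<in>\<Psi>. near (K n) e \<phi> \<psi>)"
  obtains D where "D \<subseteq> \<Phi>" "|D| \<le>o r" "\<forall>\<phi>\<in>\<Phi>. \<forall>n. \<forall>e>0. \<exists>d\<in>D. near (K n) e \<phi> d"
proof -
  have "\<exists>\<Psi>. \<Psi> \<subseteq> \<Phi> \<and> |\<Psi>| \<le>o r \<and> (\<forall>\<phi>\<in>\<Phi>. \<exists>\<psi>\<in>\<Psi>. near (K n) (1 / (real m + 1)) \<phi> \<psi>)" for n m
    by (rule net) simp
  then obtain \<Psi> where \<Psi>: "\<And>n m. \<Psi> n m \<subseteq> \<Phi> \<and> |\<Psi> n m| \<le>o r \<and>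
      (\<forall>\<phi>\<in>\<Phi>. \<exists>\<psi>\<in>\<Psi> n m. near (K n) (1 / (real m + 1)) \<phi> \<psi>)"
    by metis
  show thesis
  proof (rule that[of "\<Union>n. \<Union>m. \<Psi> n m"])
    show "|\<Union>n. \<Union>m. \<Psi> n m| \<le>o r"
      using \<Psi> r countable_ordLeq_Cinfinite[of "UNIV :: nat set" r]
      by (intro UNION_Cinfinite_bound ballI) auto
    show "\<forall>\<phi>\<in>\<Phi>. \<forall>n. \<forall>e>0. \<exists>d\<in>\<Union>n. \<Union>m. \<Psi> n m. near (K n) e \<phi> d"
    proof (intro ballI allI impI)
      fix \<phi> n and e :: real assume \<phi>: "\<phi> \<in> \<Phi>" and "e > 0"
      then obtain m where m: "1 / (real m + 1) < e"
        using reals_Archimedean[of e] by (auto simp: inverse_eq_divide add.commute)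
      obtain d where d: "d \<in> \<Psi> n m" "near (K n) (1 / (real m + 1)) \<phi> d" using \<Psi> \<phi> by blast
      have "near (K n) e \<phi> d" by (rule near_mono[OF d(2)]) (use m in auto)
      then show "\<exists>d\<in>\<Union>n. \<Union>m. \<Psi> n m. near (K n) e \<phi> d" using d(1) by blast
    qed
  qed (use \<Psi> in blast)
qed

lemma dense_characters:
  assumes "Cinfinite r" "compact_weight (euclidean :: 'a topology) \<le>o r"
  obtains E :: "('a \<Rightarrow> complex) set" where "E \<subseteq> characters" "|E| \<le>o r"
    "\<forall>\<phi>\<in>characters. \<forall>n. \<forall>e>0. \<exists>d\<in>E. near (K n) e \<phi> d"
proof (rule dense_subset_from_nets[OF assms(1), of "characters :: ('a \<Rightarrow> complex) set"])
  fix n and e :: real assume e: "e > 0"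
  have w: "weight (subtopology euclidean (K n)) \<le>o r"
    using weight_le_compact_weight[of euclidean "K n"] compact_K[of n] assms(2) ordLeq_transitive
    by auto
  have "compact_space (subtopology euclidean (K n))"
    using compact_K by (simp add: compact_space_subtopology)
  from uniform_net_le_weight[OF this w assms(1) _ e, of characters]
  obtain \<Psi> where "\<Psi> \<subseteq> characters" "|\<Psi>| \<le>o r"
      "\<forall>f\<in>characters. \<exists>g\<in>\<Psi>. \<forall>y\<in>topspace (subtopology euclidean (K n)). norm (f y - g y) \<le> e"
    by (auto simp: charactersD(1))
  then show "\<exists>\<Psi>. \<Psi> \<subseteq> characters \<and> |\<Psi>| \<le>o r \<and> (\<forall>\<phi>\<in>characters. \<exists>\<psi>\<in>\<Psi>. near (K n) e \<phi> \<psi>)"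
    by (intro exI[of _ \<Psi>]) (auto simp: near_def)
qed (use that in blast)

text \<open>Characters trivial on \<open>H\<close> are continuous functions on the quotient, where
  the image of \<open>K n\<close> is compact of weight at most \<open>r\<close>; uniform nets there
  are pulled back.\<close>

lemma dense_trivial_characters:
  assumes H: "add_subgroup (H :: 'a set)" and "Cinfinite r" "compact_weight (quotient_space H) \<le>o r"
  obtains D where "D \<subseteq> {\<phi>\<in>characters. \<forall>x\<in>H. \<phi> x = 1}" "|D| \<le>o r"
    "\<forall>\<phi>\<in>{\<phi>\<in>characters. \<forall>x\<in>H. \<phi> x = 1}. \<forall>n. \<forall>e>0. \<exists>d\<in>D. near (K n) e \<phi> d"
proof -
  define \<Delta> where "\<Delta> = {\<phi>\<in>characters. \<forall>x\<in>H. \<phi> x = 1}"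
  have lift: "lift_coset H \<phi> (x +o H) = \<phi> x" "continuous_map (quotient_space H) euclidean (lift_coset H \<phi>)"
    if "\<phi> \<in> \<Delta>" for \<phi> x
    using lift_coset[OF H] that by (auto simp: \<Delta>_def)
  show thesis
  proof (rule dense_subset_from_nets[OF assms(2), of \<Delta>])
    fix n and e :: real assume e: "e > 0"
    let ?L = "(\<lambda>x. x +o H) ` K n"
    have L: "compactin (quotient_space H) ?L"
      by (rule image_compactin[OF _ quotient_imp_continuous_map[OF quotient_map_quotient_space]])
        (simp add: compact_K)
    then have w: "weight (subtopology (quotient_space H) ?L) \<le>o r"
      using weight_le_compact_weight assms(3) ordLeq_transitive by blast
    have L': "compact_space (subtopology (quotient_space H) ?L)"
      using L by (simp add: compactin_subspace)
    have cont: "continuous_map (subtopology (quotient_space H) ?L) euclidean f" if "f \<in> lift_coset H ` \<Delta>" for f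
      using that lift(2) by (auto intro: continuous_map_from_subtopology)
    obtain \<Psi> where \<Psi>: "\<Psi> \<subseteq> lift_coset H ` \<Delta>" "|\<Psi>| \<le>o r"
        "\<forall>f\<in>lift_coset H ` \<Delta>. \<exists>g\<in>\<Psi>. \<forall>y\<in>topspace (subtopology (quotient_space H) ?L). norm (f y - g y) \<le> e"
      by (rule uniform_net_le_weight[OF L' w assms(2) cont e])
    have top: "topspace (subtopology (quotient_space H) ?L) = ?L"
      by (auto simp: topspace_quotient_space)
    define \<Psi>' where "\<Psi>' = (\<lambda>g x. g (x +o H)) ` \<Psi>"
    have "\<Psi>' \<subseteq> \<Delta>"
    proof
      fix \<psi> assume "\<psi> \<in> \<Psi>'"
      then obtain \<phi> where "\<phi> \<in> \<Delta>" "\<psi> = (\<lambda>x. lift_coset H \<phi> (x +o H))"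
        using \<Psi>(1) by (auto simp: \<Psi>'_def)
      then show "\<psi> \<in> \<Delta>" using lift(1) by simp
    qed
    moreover have "|\<Psi>'| \<le>o r" unfolding \<Psi>'_def by (rule card_of_image_ordLeq[OF \<Psi>(2)])
    moreover have "\<exists>\<psi>\<in>\<Psi>'. near (K n) e \<phi> \<psi>" if \<phi>: "\<phi> \<in> \<Delta>" for \<phi>
    proof -
      obtain g where g: "g \<in> \<Psi>" "\<forall>y\<in>?L. norm (lift_coset H \<phi> y - g y) \<le> e"
        using \<Psi>(3) \<phi> unfolding top by blast
      then have "near (K n) e \<phi> (\<lambda>x. g (x +o H))" using lift(1)[OF \<phi>] by (simp add: near_def)
      then show ?thesis using g(1) by (auto simp: \<Psi>'_def)
    qed
    ultimately show "\<exists>\<Psi>. \<Psi> \<subseteq> \<Delta> \<and> |\<Psi>| \<le>o r \<and> (\<forall>\<phi>\<in>\<Delta>. \<exists>\<psi>\<in>\<Psi>. near (K n) e \<phi> \<psi>)" by blast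
  qed (use that in \<open>simp add: \<Delta>_def\<close>)
qed

text \<open>The totally bounded sets \<open>net_set F A g\<close> are cofinal: \<open>F\<close> absorbs the cosets of the open subgroup
  of characters that are trivial on a compact subgroup, and the bounds \<open>g\<close> on an enumeration of \<open>A\<close>
  select the finite nets inside this subgroup.\<close>

definition net_set :: "('a \<Rightarrow> complex) set \<Rightarrow> ('a \<Rightarrow> complex) set \<Rightarrow> (nat \<Rightarrow> nat) \<Rightarrow> ('a \<Rightarrow> complex) set" where
  "net_set F A g = {\<lambda>x. f x * \<psi> x |f \<psi>. f \<in> F \<and> \<psi> \<in> characters \<and>
     (\<forall>n. \<exists>d\<in>A. to_nat_on A d \<le> g n \<and> near (K n) (1 / (real n + 1)) \<psi> d)}"

text \<open>For given \<open>n\<close> and \<open>e\<close> a single scale \<open>N\<close>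
  suffices: the enumeration of \<open>A\<close> is injective, so only finitely many \<open>d\<close>
  have index at most \<open>g N\<close>, and the products of these with members of \<open>F\<close>
  form a net.\<close>

lemma tb_net_set:
  assumes F: "finite F" "F \<subseteq> characters" and A: "countable A" "A \<subseteq> characters"
  shows "tb (net_set F A g)"
  unfolding tb_def
proof (intro conjI allI impI)
  show "net_set F A g \<subseteq> characters"
    using F(2) by (auto simp: net_set_def intro!: mult_in_characters)
  fix n and e :: real assume "e > 0"
  then obtain m where m: "1 / (real m + 1) < e"
    using reals_Archimedean[of e] by (auto simp: inverse_eq_divide add.commute)
  define N where "N = max m n"
  have "1 / (real N + 1) \<le> 1 / (real m + 1)" by (intro divide_left_mono) (auto simp: N_def)
  with m have N: "1 / (real N + 1) \<le> e" by linarith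
  define A' where "A' = {d\<in>A. to_nat_on A d \<le> g N}"
  have "inj_on (to_nat_on A) A'"
    using inj_on_to_nat_on[OF A(1)] by (rule inj_on_subset) (auto simp: A'_def)
  moreover have "to_nat_on A ` A' \<subseteq> {..g N}" by (auto simp: A'_def)
  ultimately have fin: "finite A'" by (meson finite_atMost finite_imageD finite_subset)
  define C where "C = (\<lambda>(f, d) x. f x * d x) ` (F \<times> A')"
  have "finite C" unfolding C_def using F(1) fin by simp
  moreover have "C \<subseteq> characters"
    using F(2) A(2) by (auto simp: C_def A'_def intro!: mult_in_characters)
  moreover have "\<exists>c\<in>C. near (K n) e \<phi> c" if \<phi>: "\<phi> \<in> net_set F A g" for \<phi>
  proof -
    obtain f \<psi> where f: "f \<in> F" "\<phi> = (\<lambda>x. f x * \<psi> x)" and \<psi>: "\<psi> \<in> characters"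
        "\<forall>n. \<exists>d\<in>A. to_nat_on A d \<le> g n \<and> near (K n) (1 / (real n + 1)) \<psi> d"
      using \<phi> unfolding net_set_def by blast
    obtain d where d: "d \<in> A'" "near (K N) (1 / (real N + 1)) \<psi> d" using \<psi>(2) unfolding A'_def by blast
    have "near (K n) e \<psi> d" by (rule near_mono[OF d(2) mono_K N]) (simp add: N_def)
    moreover have "near (K n) 0 f f" by (rule near_refl) simp
    ultimately have "near (K n) e \<phi> (\<lambda>x. f x * d x)"
      unfolding f(2) using \<psi>(1) f(1) F(2) by (intro near_mult_characters[of "K n" 0 f f e \<psi> d e]) auto
    then show ?thesis using f(1) d(1) by (auto simp: C_def)
  qed
  ultimately show "\<exists>F'. finite F' \<and> F' \<subseteq> characters \<and> (\<forall>\<phi>\<in>net_set F A g. \<exists>f\<in>F'. near (K n) e \<phi> f)"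
    by (intro exI[of _ C]) blast
qed

text \<open>A finite \<open>F\<close> approximates \<open>P\<close> within \<open>1 / 2\<close> on a
  \<open>K n0\<close> containing \<open>H\<close>, so every quotient \<open>\<phi> / f\<close> with
  \<open>f\<close> near \<open>\<phi>\<close> is trivial on \<open>H\<close>. The totally bounded
  set \<open>P'\<close> of such quotients has finite nets \<open>C n\<close> inside
  \<open>D\<close>; some \<open>A\<close> absorbs them all, and \<open>g\<close> bounds their
  indices in \<open>A\<close>.\<close>

lemma tb_subset_net_set:
  assumes P: "tb P" and H: "add_subgroup H" "compact H"
    and E: "E \<subseteq> characters" "\<forall>\<phi>\<in>characters. \<forall>n. \<forall>e>0. \<exists>d\<in>E. near (K n) e \<phi> d"
    and D: "\<forall>\<phi>\<in>{\<phi>\<in>characters. \<forall>x\<in>H. \<phi> x = 1}. \<forall>n. \<forall>e>0. \<exists>d\<in>D. near (K n) e \<phi> d"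
    and \<A>: "\<forall>A\<in>\<A>. countable A" "\<forall>A. countable A \<and> A \<subseteq> D \<longrightarrow> (\<exists>A'\<in>\<A>. A \<subseteq> A')"
    and G: "cofinal_in UNIV (\<le>) G"
  shows "\<exists>F A g. finite F \<and> F \<subseteq> E \<and> A \<in> \<A> \<and> g \<in> G \<and> P \<subseteq> net_set F A g"
proof -
  have PX: "P \<subseteq> characters" using P by (simp add: tb_def)
  obtain n0 where n0: "H \<subseteq> K n0" using compact_subset_K[OF H(2)] by blast
  obtain F where F: "finite F" "F \<subseteq> E" "\<forall>\<phi>\<in>P. \<exists>f\<in>F. near (K n0) (1 / 2) \<phi> f"
  proof (rule tb_centres[OF P, of "1 / 2" E n0])
    fix \<phi> assume "\<phi> \<in> P"
    then have "\<phi> \<in> characters" using PX by blast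
    then show "\<exists>d\<in>E. near (K n0) (1 / 2 / 3) \<phi> d" using E(2) by simp
  qed auto
  have FX: "F \<subseteq> characters" using F(2) E(1) by blast
  define P' where "P' = (\<Union>f\<in>F. (\<lambda>\<phi> x. \<phi> x / f x) ` P) \<inter> {\<phi>\<in>characters. \<forall>x\<in>H. \<phi> x = 1}"
  have "tb (\<Union>f\<in>F. (\<lambda>\<phi> x. \<phi> x / f x) ` P)"
    using F(1) by (rule tb_finite_Union) (use tb_divide[OF P] FX in blast)
  then have P': "tb P'" by (rule tb_subset) (auto simp: P'_def)
  have "\<exists>C. finite C \<and> C \<subseteq> D \<and> (\<forall>\<psi>\<in>P'. \<exists>c\<in>C. near (K n) (1 / (real n + 1)) \<psi> c)" for n
  proof (rule tb_centres[OF P', of "1 / (real n + 1)" D n])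
    fix \<psi> assume "\<psi> \<in> P'"
    then have "\<psi> \<in> {\<phi>\<in>characters. \<forall>x\<in>H. \<phi> x = 1}" by (simp add: P'_def)
    then show "\<exists>d\<in>D. near (K n) (1 / (real n + 1) / 3) \<psi> d" using D by simp
  qed auto
  then obtain C where C: "\<And>n. finite (C n) \<and> C n \<subseteq> D \<and>
      (\<forall>\<psi>\<in>P'. \<exists>c\<in>C n. near (K n) (1 / (real n + 1)) \<psi> c)"
    by metis
  have "countable (\<Union>n. C n)" using C by (auto intro: countable_finite)
  moreover have "(\<Union>n. C n) \<subseteq> D" using C by blast
  ultimately obtain A where A: "A \<in> \<A>" "(\<Union>n. C n) \<subseteq> A" using \<A>(2) by blast
  obtain g where g: "g \<in> G" "(\<lambda>n. Max (insert 0 (to_nat_on A ` C n))) \<le> g"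
    using G by (auto simp: cofinal_in_def)
  have "P \<subseteq> net_set F A g"
  proof
    fix \<phi> assume \<phi>: "\<phi> \<in> P"
    then obtain f where f: "f \<in> F" "near (K n0) (1 / 2) \<phi> f" using F(3) by blast
    have \<phi>X: "\<phi> \<in> characters" and fX: "f \<in> characters" using \<phi> PX f(1) FX by auto
    define \<psi> where "\<psi> = (\<lambda>x. \<phi> x / f x)"
    have \<psi>X: "\<psi> \<in> characters" unfolding \<psi>_def by (rule divide_in_characters[OF \<phi>X fX])
    have "near H (1 / 2) \<psi> (\<lambda>x. 1)"
      using f(2) n0 by (auto simp: near_def \<psi>_def norm_divide_minus_one charactersD(2)[OF fX])
    then have "\<forall>x\<in>H. \<psi> x = 1" using character_trivial_on_subgroup[OF H(1) \<psi>X] by blast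
    then have \<psi>: "\<psi> \<in> P'" using \<psi>X f(1) \<phi> by (auto simp: P'_def \<psi>_def)
    have "\<phi> = (\<lambda>x. f x * \<psi> x)" using character_nonzero[OF fX] by (simp add: \<psi>_def)
    moreover have "\<exists>d\<in>A. to_nat_on A d \<le> g n \<and> near (K n) (1 / (real n + 1)) \<psi> d" for n
    proof -
      obtain c where c: "c \<in> C n" "near (K n) (1 / (real n + 1)) \<psi> c" using C \<psi> by blast
      have "to_nat_on A c \<le> Max (insert 0 (to_nat_on A ` C n))"
        using C c(1) by (intro Max_ge) auto
      also have "\<dots> \<le> g n" using le_funD[OF g(2)] .
      finally show ?thesis using c A(2) by blast
    qed
    ultimately show "\<phi> \<in> net_set F A g" using f(1) \<psi>X unfolding net_set_def by blast
  qed
  then show ?thesis using F(1,2) A(1) g(1) by blast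
qed

text \<open>Each \<open>net_set\<close> lies in the polar of some neighbourhood \<open>N\<close>. If
  the polar of a quasiconvex \<open>V\<close> is inside the \<open>net_set\<close>, it is inside the
  polar of \<open>N\<close>, and then \<open>N\<close> is inside \<open>V\<close>; so these
  neighbourhoods form a local base.\<close>

lemma topological_character_le:
  assumes r: "Cinfinite r" and kap: "compact_weight (euclidean :: 'a topology) \<le>o r"
    and d: "dominating_number \<le>o r"
    and H: "add_subgroup (H :: 'a set)" "compact H"
    and lam: "lam = compact_weight (quotient_space H)"
    and cof: "cof (countably_infinite_subsets lam) (\<subseteq>) \<le>o r"
  shows "topological_character TYPE('a) \<le>o r"
proof -
  obtain E where E: "E \<subseteq> characters" "|E| \<le>o r"
      "\<forall>\<phi>\<in>characters. \<forall>n. \<forall>e>0. \<exists>d\<in>E. near (K n) e \<phi> d"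
    by (rule dense_characters[OF r kap])
  have Cl: "Card_order lam" unfolding lam by (rule Card_order_compact_weight)
  obtain D \<A> where D: "D \<subseteq> {\<phi>\<in>characters. \<forall>x\<in>H. \<phi> x = 1}"
      "\<forall>\<phi>\<in>{\<phi>\<in>characters. \<forall>x\<in>H. \<phi> x = 1}. \<forall>n. \<forall>e>0. \<exists>d\<in>D. near (K n) e \<phi> d"
    and \<A>: "|\<A>| \<le>o r" "\<forall>A\<in>\<A>. countable A \<and> A \<subseteq> D"
      "\<forall>A. countable A \<and> A \<subseteq> D \<longrightarrow> (\<exists>A'\<in>\<A>. A \<subseteq> A')"
  proof (cases "countable (Field lam)")
    \<comment> \<open>Here \<open>D\<close> itself is countable and \<open>{D}\<close> serves as the
      family, whereas for finite \<open>Field lam\<close> there are no countably infinite subsets to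
      transport.\<close>
    case True
    have "lam =o |Field lam|" using card_of_Field_ordIso[OF Cl] by (rule ordIso_symmetric)
    also have "|Field lam| \<le>o natLeq" by (rule countable_ordLeq_Cinfinite[OF True natLeq_Cinfinite])
    finally have "compact_weight (quotient_space H) \<le>o natLeq" by (simp add: lam)
    then obtain D where D: "D \<subseteq> {\<phi>\<in>characters. \<forall>x\<in>H. \<phi> x = 1}" "|D| \<le>o natLeq"
      "\<forall>\<phi>\<in>{\<phi>\<in>characters. \<forall>x\<in>H. \<phi> x = 1}. \<forall>n. \<forall>e>0. \<exists>d\<in>D. near (K n) e \<phi> d"
      by (rule dense_trivial_characters[OF H(1) natLeq_Cinfinite])
    have "|D| \<le>o |UNIV :: nat set|"
      by (rule ordLeq_ordIso_trans[OF D(2) ordIso_symmetric[OF card_of_nat]])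
    then obtain f :: "_ \<Rightarrow> nat" where "inj_on f D" unfolding card_of_ordLeq[symmetric] by blast
    then have "countable D" by (auto simp: countable_def)
    moreover have "|{D}| \<le>o r" using r by (intro countable_ordLeq_Cinfinite) auto
    ultimately show thesis using that[OF D(1,3), of "{D}"] by simp
  next
    case False
    then have inf: "infinite (Field lam)" using countable_finite by blast
    then have "Cinfinite lam" using Cl by (simp add: cinfinite_def)
    then obtain D where D: "D \<subseteq> {\<phi>\<in>characters. \<forall>x\<in>H. \<phi> x = 1}" "|D| \<le>o lam"
      "\<forall>\<phi>\<in>{\<phi>\<in>characters. \<forall>x\<in>H. \<phi> x = 1}. \<forall>n. \<forall>e>0. \<exists>d\<in>D. near (K n) e \<phi> d"
      by (rule dense_trivial_characters[OF H(1), of lam])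
        (use lam ordLeq_refl[OF Cl] in auto)
    obtain C where C: "cofinal_in (countably_infinite_subsets lam) (\<subseteq>) C"
        "cof (countably_infinite_subsets lam) (\<subseteq>) = |C|"
      by (rule cof_attained[of "countably_infinite_subsets lam" "(\<subseteq>)"]) auto
    have "|D| \<le>o |Field lam|"
      by (rule ordLeq_ordIso_trans[OF D(2) ordIso_symmetric[OF card_of_Field_ordIso[OF Cl]]])
    then obtain h where h: "\<forall>c\<in>C. countable (h c) \<and> h c \<subseteq> D"
        "\<forall>A. countable A \<and> A \<subseteq> D \<longrightarrow> (\<exists>c\<in>C. A \<subseteq> h c)"
      by (rule cofinal_countable_family[OF _ C(1) inf])
    have "|h ` C| \<le>o r" using cof C(2) by (intro card_of_image_ordLeq) simp
    then show thesis using that[OF D(1,3), of "h ` C"] h by simp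
  qed
  obtain G where G: "cofinal_in UNIV (\<le>) G" "dominating_number = |G|" by (rule dominating_family)
  define I where "I = {F. F \<subseteq> E \<and> finite F} \<times> (\<A> \<times> G)"
  \<comment> \<open>The three factors are controlled by the compact weight of the group, by the
    cofinality of the countable subsets and by the dominating number.\<close>
  have "|I| \<le>o r"
    unfolding I_def using \<A>(1) E(2) d G(2) r
    by (intro card_of_Times_ordLeq_Cinfinite card_of_finite_subsets_ordLeq) auto
  have "\<exists>N. open N \<and> 0 \<in> N \<and> (case p of (F, A, g) \<Rightarrow> net_set F A g) \<subseteq> polar N" if p: "p \<in> I" for p
  proof -
    obtain F A g where FAg: "p = (F, A, g)" by (cases p)
    have "tb (net_set F A g)"
      by (rule tb_net_set) (use p FAg E(1) \<A>(2) D(1) in \<open>auto simp: I_def\<close>)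
    then obtain N where "open N" "0 \<in> N" "net_set F A g \<subseteq> polar N" by (rule tb_imp_polar_nbhd)
    then show ?thesis unfolding FAg by (intro exI[of _ N]) simp
  qed
  then obtain N where N0: "\<And>p. p \<in> I \<Longrightarrow>
      open (N p) \<and> 0 \<in> N p \<and> (case p of (F, A, g) \<Rightarrow> net_set F A g) \<subseteq> polar (N p)"
    by metis
  have N: "open (N (F, A, g))" "0 \<in> N (F, A, g)" "net_set F A g \<subseteq> polar (N (F, A, g))"
    if "(F, A, g) \<in> I" for F A g
    using N0[OF that] by simp_all
  have "local_base_at 0 euclidean (N ` I)"
    unfolding local_base_at_def
  proof (intro conjI ballI allI impI)
    fix V assume "V \<in> N ` I"
    then obtain F A g where "(F, A, g) \<in> I" "V = N (F, A, g)" by (metis imageE prod_cases3)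
    then show "openin euclidean V" "0 \<in> V" using N(1,2) by simp_all
  next
    fix W :: "'a set" assume "openin euclidean W \<and> 0 \<in> W"
    then obtain V M where V: "open M" "0 \<in> M" "M \<subseteq> V" "V \<subseteq> W" "quasiconvex V"
      using lqc[of W] by auto
    have tbV: "tb (polar V)"
      by (rule tb_subset[OF tb_polar[OF V(1,2)]]) (use V(3) in \<open>auto simp: polar_def\<close>)
    have "\<forall>A\<in>\<A>. countable A" using \<A>(2) by simp
    from tb_subset_net_set[OF tbV H E(1,3) D(2) this \<A>(3) G(1)]
    obtain F A g where FAg: "finite F" "F \<subseteq> E" "A \<in> \<A>" "g \<in> G" "polar V \<subseteq> net_set F A g"
      by (elim exE conjE)
    then have i: "(F, A, g) \<in> I" by (simp add: I_def)
    have "N (F, A, g) \<subseteq> V"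
    proof
      fix z assume "z \<in> N (F, A, g)"
      then have "\<forall>\<phi>\<in>polar V. Re (\<phi> z) \<ge> 0" using N(3)[OF i] FAg(5) by (auto simp: polar_def)
      then show "z \<in> V" using quasiconvex_separated[OF V(5), of z] by (meson not_le)
    qed
    then show "\<exists>U\<in>N ` I. U \<subseteq> W" using i V(4) by blast
  qed
  then have "topological_character TYPE('a) \<le>o |N ` I|"
    unfolding topological_character_def by (rule min_Card_le)
  also have "|N ` I| \<le>o r" by (rule card_of_image_ordLeq[OF \<open>|I| \<le>o r\<close>])
  finally show ?thesis .
qed

end

section \<open>Normalising the decomposition, and combining both bounds\<close>

lemma k_omega_space_imp_group:
  assumes lqc: "locally_quasiconvex TYPE('a :: {topological_ab_group_add, t2_space})"
    and kom: "k_omega_space (euclidean :: 'a topology)"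
  obtains K :: "nat \<Rightarrow> 'a :: {topological_ab_group_add, t2_space} set" where "k_omega_group K"
proof -
  obtain K :: "nat \<Rightarrow> 'a set" where K: "\<And>n. compact (K n)" "\<And>L. compact L \<Longrightarrow> \<exists>n. L \<subseteq> K n"
      "\<And>U. (\<And>n. openin (subtopology euclidean (K n)) (U \<inter> K n)) \<Longrightarrow> open U"
    using kom unfolding k_omega_space_def by auto
  \<comment> \<open>Finite unions make the sequence increasing, and \<open>0\<close> is adjoined;
    every old set stays inside the new one, so both covering and openness transfer.\<close>
  define K' where "K' n = insert 0 (\<Union>i\<le>n. K i)" for n
  have sub: "K n \<subseteq> K' n" for n by (auto simp: K'_def)
  have "k_omega_group K'"
  proof
    show "compact (K' n)" for n
      unfolding K'_def by (intro compact_insert compact_UN K) auto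
    show "K' m \<subseteq> K' n" if "m \<le> n" for m n
      using that by (auto simp: K'_def intro: order_trans)
    show "0 \<in> K' n" for n by (simp add: K'_def)
    show "\<exists>n. L \<subseteq> K' n" if "compact L" for L
      using K(2)[OF that] sub by blast
    show "open U" if U: "\<And>n. \<exists>V. open V \<and> U \<inter> K' n = V \<inter> K' n" for U
    proof (rule K(3))
      fix n
      obtain V where "open V" "U \<inter> K' n = V \<inter> K' n" using U by blast
      then have "open V" "U \<inter> K n = V \<inter> K n" using sub[of n] by blast+
      then show "openin (subtopology euclidean (K n)) (U \<inter> K n)"
        by (auto simp: openin_subtopology)
    qed
    show "\<exists>V N. open N \<and> 0 \<in> N \<and> N \<subseteq> V \<and> V \<subseteq> W \<and> quasiconvex V" if "open W" "0 \<in> W" for W :: "'a set"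
      using lqc that unfolding locally_quasiconvex_def neighbourhood_base_at_def by (metis open_openin)
  qed
  then show thesis by (rule that)
qed

theorem theorem1p1:
  fixes kap :: "'a :: {topological_ab_group_add, t2_space} set rel"
    and lam :: "'a set set rel"
  assumes "locally_quasiconvex TYPE('a)"
    and "k_omega_space (euclidean :: 'a topology)"
    and "\<not> locally_compact_space (euclidean :: 'a topology)"
    and "kap = compact_weight (euclidean :: 'a topology)"
    and "lam = min_Card {compact_weight (quotient_space H) |H :: 'a set. add_subgroup H \<and> compact H}"
  shows "topological_character TYPE('a) =o
    max_Card dominating_number (max_Card kap (cof (countably_infinite_subsets lam) (\<subseteq>)))"
proof -
  obtain K :: "nat \<Rightarrow> 'a set" where "k_omega_group K"
    using k_omega_space_imp_group[OF assms(1,2)] .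
  then interpret k_omega_group K .
  define \<mu> where "\<mu> = cof (countably_infinite_subsets lam) (\<subseteq>)"
  define M where "M = max_Card dominating_number (max_Card kap \<mu>)"
  let ?Q = "{compact_weight (quotient_space H) |H :: 'a set. add_subgroup H \<and> compact H}"
  have "compact_weight (quotient_space {0 :: 'a}) \<in> ?Q" by (auto simp: add_subgroup_def)
  then have ne: "?Q \<noteq> {}" by blast
  have cq: "\<forall>r\<in>?Q. Card_order r" using Card_order_compact_weight by blast
  \<comment> \<open>The minimum is attained, so one compact subgroup serves for the upper bound,
    while minimality over all of them serves for the lower bound.\<close>
  have "lam \<in> ?Q" unfolding assms(5) by (rule min_Card(1)[OF ne cq])
  then obtain H :: "'a set" where H: "add_subgroup H" "compact H" "lam = compact_weight (quotient_space H)"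
    by blast
  have lam_le: "lam \<le>o compact_weight (quotient_space H)" if "add_subgroup H" "compact H" for H :: "'a set"
    using min_Card(2)[OF ne cq] that unfolding assms(5) by blast
  obtain G where G: "dominating_number = |G|" "infinite G" by (rule dominating_family)
  have Cd: "Card_order dominating_number" unfolding G(1) by (rule card_of_Card_order)
  have Ck: "Card_order kap" unfolding assms(4) by (rule Card_order_compact_weight)
  have C\<mu>: "Card_order \<mu>"
    unfolding \<mu>_def by (rule cof_attained[of "countably_infinite_subsets lam" "(\<subseteq>)"]) (simp_all add: card_of_Card_order)
  note Cm = Card_order_max_Card
  have M: "dominating_number \<le>o M" "kap \<le>o M" "\<mu> \<le>o M"
    using max_Card_upper[OF Cd Cm[of kap \<mu>]] max_Card_upper[OF Ck C\<mu>] ordLeq_transitive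
    unfolding M_def by blast+
  have "Cinfinite dominating_number" unfolding G(1) using G(2) by (rule Cinfinite_card_of)
  then have "Cinfinite M"
    using M(1) cinfinite_mono[of dominating_number M] Cm by (auto simp: M_def)
  then have upper: "topological_character TYPE('a) \<le>o M"
    using M H by (intro topological_character_le[of M H lam]) (auto simp: assms(4) \<mu>_def)
  obtain B where B: "local_base_at (0 :: 'a) euclidean B" "topological_character TYPE('a) = |B|"
  proof (rule min_Card_attained[of "local_base_at (0 :: 'a) euclidean" "{U. open U \<and> 0 \<in> U}"])
    show "local_base_at (0 :: 'a) euclidean {U. open U \<and> 0 \<in> U}" by (auto simp: local_base_at_def)
  qed (use that in \<open>simp add: topological_character_def\<close>)
  have dB: "dominating_number \<le>o |B|" by (rule dominating_number_le[OF assms(3) B(1)])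
  \<comment> \<open>The bound by the dominating number comes first, as it supplies the infinity of
    \<open>B\<close> that the compact weight bound requires.\<close>
  then have "infinite B" using G card_of_ordLeq_infinite by metis
  then have "kap \<le>o |B|" unfolding assms(4) by (rule compact_weight_le_local_base[OF B(1)])
  moreover have "\<mu> \<le>o |B|"
    unfolding \<mu>_def using H(3) Card_order_compact_weight by (intro cof_countable_subsets_le[OF B(1) _ lam_le]) auto
  ultimately have "M \<le>o |B|"
    unfolding M_def by (intro max_Card_least dB Cd Ck C\<mu> Cm)
  then show ?thesis
    using upper unfolding M_def \<mu>_def B(2) by (simp add: ordIso_iff_ordLeq)
qed

end
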